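(* Let $\alpha$ be a positive real number. For any partition $\lambda$ and any integer $r\ge0$ one has $$s_r(\lambda)=\sum_{i=0}^{\lfloor r/2\rfloor}\ \sum_{j=0}^{r-2i}\ \sum_{k=0}^{\min(i,j)}\frac{1}{\alpha^i}\left(1-\frac1\alpha\right)^{r-2i-j}\binom{|\lambda|+i-1}{i-k}\sum_{|\rho|=j}u_{ijk}^{\rho}(r)\,\frac{d_\rho(\lambda)}{z_\rho},$$ where the coefficients $u_{ijk}^{\rho}(r)$ are positive integers, given by $$u_{ijk}^{\rho}(r)=\sum_{s=0}^{j}\genfrac{\langle}{\rangle}{0pt}{}{\rho}{s}_{k}\binom{r+s-i-j-1}{r-2i-j}.$$ In other words, $$s_r(\lambda)=\sum_{\substack{n,p,q\ge0\\ 2n+p+q\le r}}\frac{1}{\alpha^n}\left(1-\frac1\alpha\right)^p\binom{n+p+q-1}{p}\left(\sum_{k=0}^{\min(n,r-2n-p)}\binom{|\lambda|+n-1}{n-k}F_{r-2n-p,q,k}(\lambda)\right).$$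
   Context: A partition $\mu=(\mu_1,\ldots,\mu_l)$ is a finite weakly decreasing sequence of positive integers; $l(\mu)=l$ is its length, $|\mu|=\sum_i\mu_i$ its weight, $m_i(\mu)$ the number of parts equal to $i$, and $z_\mu=\prod_{i\ge1} i^{m_i(\mu)}m_i(\mu)!$. A partition is identified with its diagram $\{(i,j):1\le i\le l(\mu),\,1\le j\le\mu_i\}$; put $\mu_i=0$ for $i>l(\mu)$. Write $\binom{a}{n}=a(a-1)\cdots(a-n+1)/n!$ for $n\ge 0$ (so $\binom a0=1$ for every $a$); $\binom{a}{n}=0$ for $n<0$. Powers with exponent $0$ equal $1$. The quantity $s_r(\lambda)$ is $$s_r(\lambda)=\sum_{i=1}^{l(\lambda)+1}\left(\lambda_i-\frac{i-1}{\alpha}\right)^r c_i^\alpha(\lambda),\qquad c_i^{\alpha}(\lambda)=\frac{1}{\alpha\lambda_i+l(\lambda)-i+2}\prod_{\substack{j=1\\ j\ne i}}^{l(\lambda)+1}\frac{\alpha(\lambda_i-\lambda_j)+j-i+1}{\alpha(\lambda_i-\lambda_j)+j-i}.$$ (The $c_i^\alpha(\lambda)$ are the Pieri coefficients of Jack polynomials: $e_1J_\lambda^\alpha=\sum_i c_i^\alpha(\lambda)J^\alpha_{\lambda^{(i)}}$, where $\lambda^{(i)}$ is obtained from $\lambda$ by increasing $\lambda_i$ by one, and $c_i^\alpha(\lambda)=0$ when $\lambda^{(i)}$ is not a partition.) For a cell $(i,j)\in\lambda$ let $c_{ij}^{\alpha}=j-1-(i-1)/\alpha$. For $k\ge1$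 put $d_k(\lambda)=\sum_{(i,j)\in\lambda}(c_{ij}^\alpha)^k$, and for a partition $\rho$ put $d_\rho(\lambda)=\prod_{i\ge1}d_i(\lambda)^{m_i(\rho)}$. For integers $n,p,k$ with $n\ge 1$, $k\ge1$, $0\le p\le n$ define $$\binom{n}{p}_{k}=\frac{n}{k}\sum_{r\ge0}\binom{p}{r}\binom{n-p}{r}\binom{n-r-1}{k-r-1}.$$ For a nonempty partition $\mu$ and integers $0\le p\le|\mu|$, $k\ge1$ define $$\genfrac{\langle}{\rangle}{0pt}{}{\mu}{p}_{k}=\sum_{(p_i)}\sum_{(k_i)}\prod_{i=1}^{l(\mu)}\binom{\mu_i}{p_i}_{k_i},$$ the sum being over all decompositions $p=\sum_{i}p_i$, $k=\sum_{i}k_i$ with $0\le p_i\le\mu_i$ and $k_i\ge 1$ for all $i$. For $k=0$ this symbol is $0$, except that it equals $1$ when $\mu$ is the empty partition and $p=0$. For $n\ge1$, $k\ge1$, $0\le p\le n$ define $$F_{npk}(\lambda)=\sum_{|\mu|=n}\frac{1}{z_\mu}\genfrac{\langle}{\rangle}{0pt}{}{\mu}{p}_{k}\,d_\mu(\lambda)$$ (sum over partitions $\mu$ of $n$); for $k=0$, $F_{np0}(\lambda)=0$ with the only exception $F_{000}(\lambda)=1$.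
   Formalization: "Positive integers" fails for some indices (e.g. r=1, i=j=k=0, empty ρ gives u=0); instead it is proved that every coefficient u is a nonnegative integer, and is positive exactly when l(ρ) ≤ k and (i+j > 0 or r = 0). *)

theory Defs
  imports Complex_Main
begin

definition is_partition :: "nat list \<Rightarrow> bool" where
  "is_partition \<mu> \<longleftrightarrow> sorted_wrt (\<ge>) \<mu> \<and> (\<forall>x\<in>set \<mu>. 0 < x)"

definition partitions_of :: "nat \<Rightarrow> nat list set" where
  "partitions_of n = {\<mu>. is_partition \<mu> \<and> sum_list \<mu> = n}"

text \<open>The parts are numbered from 1, as on paper, and continued by 0 beyond the length.\<close>

definition part :: "nat list \<Rightarrow> nat \<Rightarrow> nat" where
  "part \<mu> i = (if 1 \<le> i \<and> i \<le> length \<mu> then \<mu> ! (i - 1) else 0)"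

definition diagram :: "nat list \<Rightarrow> (nat \<times> nat) set" where
  "diagram \<mu> = {(i, j). 1 \<le> i \<and> i \<le> length \<mu> \<and> 1 \<le> j \<and> j \<le> part \<mu> i}"

text \<open>In the products over multiplicities below only the \<open>i\<close> that occur as parts contribute
  a factor different from 1.\<close>

definition zee :: "nat list \<Rightarrow> nat" where
  "zee \<mu> = (\<Prod>i\<in>set \<mu>. i ^ count_list \<mu> i * fact (count_list \<mu> i))"

text \<open>Binomial coefficients with arbitrary upper argument, zero for negative lower argument.\<close>

definition binom :: "real \<Rightarrow> int \<Rightarrow> real" where
  "binom a n = (if n < 0 then 0 else a gchoose nat n)"

definition pieri :: "real \<Rightarrow> nat list \<Rightarrow> nat \<Rightarrow> real" where
  "pieri \<alpha> \<mu> i =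
     1 / (\<alpha> * real (part \<mu> i) + real (length \<mu>) - real i + 2) *
     (\<Prod>j\<in>{1..length \<mu> + 1} - {i}.
        (\<alpha> * (real (part \<mu> i) - real (part \<mu> j)) + real j - real i + 1) /
        (\<alpha> * (real (part \<mu> i) - real (part \<mu> j)) + real j - real i))"

definition s_sum :: "real \<Rightarrow> nat \<Rightarrow> nat list \<Rightarrow> real" where
  "s_sum \<alpha> r \<mu> =
     (\<Sum>i=1..length \<mu> + 1. (real (part \<mu> i) - (real i - 1) / \<alpha>) ^ r * pieri \<alpha> \<mu> i)"

definition cell_content :: "real \<Rightarrow> nat \<Rightarrow> nat \<Rightarrow> real" where
  "cell_content \<alpha> i j = real j - 1 - (real i - 1) / \<alpha>"

definition d_pow :: "real \<Rightarrow> nat \<Rightarrow> nat list \<Rightarrow> real" where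
  "d_pow \<alpha> k \<mu> = (\<Sum>(i, j)\<in>diagram \<mu>. cell_content \<alpha> i j ^ k)"

definition d_part :: "real \<Rightarrow> nat list \<Rightarrow> nat list \<Rightarrow> real" where
  "d_part \<alpha> \<rho> \<mu> = (\<Prod>i\<in>set \<rho>. d_pow \<alpha> i \<mu> ^ count_list \<rho> i)"

text \<open>Meaningful for \<open>1 \<le> n\<close>, \<open>1 \<le> k\<close> and \<open>p \<le> n\<close>. The terms with \<open>r > p\<close> vanish because of
  the factor \<open>binom p r\<close>, so the sum over all \<open>r\<close> is cut off at \<open>p\<close>.\<close>

definition gbinom :: "nat \<Rightarrow> nat \<Rightarrow> nat \<Rightarrow> real" where
  "gbinom n p k =
     real n / real k *
     (\<Sum>r\<le>p. binom (real p) (int r) * binom (real n - real p) (int r) *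
             binom (real n - real r - 1) (int k - int r - 1))"

definition p_decomps :: "nat list \<Rightarrow> nat \<Rightarrow> nat list set" where
  "p_decomps \<mu> p =
     {ps. length ps = length \<mu> \<and> sum_list ps = p \<and> (\<forall>i<length \<mu>. ps ! i \<le> \<mu> ! i)}"

definition k_decomps :: "nat list \<Rightarrow> nat \<Rightarrow> nat list set" where
  "k_decomps \<mu> k = {ks. length ks = length \<mu> \<and> sum_list ks = k \<and> (\<forall>x\<in>set ks. 1 \<le> x)}"

definition gsymb :: "nat list \<Rightarrow> nat \<Rightarrow> nat \<Rightarrow> real" where
  "gsymb \<mu> p k =
     (if k = 0 then (if \<mu> = [] \<and> p = 0 then 1 else 0)
      else \<Sum>ps\<in>p_decomps \<mu> p. \<Sum>ks\<in>k_decomps \<mu> k.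
             \<Prod>i<length \<mu>. gbinom (\<mu> ! i) (ps ! i) (ks ! i))"

definition F_fun :: "real \<Rightarrow> nat \<Rightarrow> nat \<Rightarrow> nat \<Rightarrow> nat list \<Rightarrow> real" where
  "F_fun \<alpha> n p k l =
     (if k = 0 then (if n = 0 \<and> p = 0 then 1 else 0)
      else \<Sum>\<mu>\<in>partitions_of n. 1 / real (zee \<mu>) * gsymb \<mu> p k * d_part \<alpha> \<mu> l)"

definition u_coeff :: "nat list \<Rightarrow> nat \<Rightarrow> nat \<Rightarrow> nat \<Rightarrow> nat \<Rightarrow> real" where
  "u_coeff \<rho> i j k r =
     (\<Sum>s=0..j. gsymb \<rho> s k *
        binom (real r + real s - real i - real j - 1) (int r - 2 * int i - int j))"

end

theory Submission
  imports Defs "HOL-Computational_Algebra.Polynomial_FPS" "HOL-Library.Multiset"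
begin

text \<open>
  Write \<open>b = 1/\<alpha>\<close> and \<open>w = 1 - b\<close>. Both sides are the coefficients of \<open>u^r\<close> in the same product
  over the cells of the diagram of \<open>\<lambda>\<close>.

  The Pieri coefficient \<open>c\<^sub>i\<close> is the residue at \<open>z = x\<^sub>i = \<lambda>\<^sub>i - (i - 1) b\<close> of the rational function
  \<open>\<Prod>\<^bsub>j \<le> n\<^esub> (z - x\<^sub>j + b) / \<Prod>\<^bsub>j \<le> n + 1\<^esub> (z - x\<^sub>j)\<close>, where \<open>n\<close> is the length of \<open>\<lambda>\<close>. Lagrange
  interpolation therefore evaluates \<open>\<Sum>\<^sub>r s\<^sub>r u^r\<close> as a product over rows, and each row telescopes
  into its cells (\<open>s_sum_series\<close>):
  \<open>\<Sum>\<^sub>r s\<^sub>r u^r = \<Prod>\<^sub>c (1 - c u) (1 - (c + w) u) / ((1 - (c + 1) u) (1 - (c - b) u))\<close>,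
  where \<open>c\<close> runs over the contents of the cells.

  For the other side, the bracket symbol of a one-part partition \<open>n\<close> with parameters \<open>p\<close>, \<open>k\<close> is
  \<open>n / k\<close> times the coefficient of \<open>x^n t^p\<close> in \<open>V^k\<close>, where \<open>V = 1 / ((1 - x) (1 - t x)) - 1\<close>
  (\<open>vec_series_power_nth\<close>). Hence \<open>\<Sum>\<^bsub>n,p,k\<^esub> (symbol) t^p y^k x^n\<close> is \<open>x d/dx\<close> of the logarithm of
  \<open>1 / (1 - y V)\<close>. The sum over partitions weighted by \<open>1/z\<^sub>\<mu>\<close> exponentiates such sums, and the
  power sums \<open>d\<^sub>n\<close> are sums over cells; so
  \<open>\<Sum>\<^bsub>m,q,k\<^esub> F\<^bsub>mqk\<^esub> x^m t^q y^k = \<Prod>\<^sub>c 1 / (1 - y V(c x))\<close> (\<open>partition_series_eq_prod\<close>).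

  In the claimed expansion the sum over \<open>p\<close> is \<open>(1 - w u)^{-(n + q)}\<close>, which amounts to putting
  \<open>t = 1 / (1 - w u)\<close>; and with \<open>Z = b u^2 t\<close> the sum over \<open>n\<close> is
  \<open>\<Sum>\<^sub>n (|\<lambda>| + n - 1 choose n - k) Z^n = (1 - Z)^{-|\<lambda>|} (Z / (1 - Z))^k\<close>, which amounts to
  \<open>y = Z / (1 - Z)\<close>, together with one factor \<open>1 / (1 - Z)\<close> for every cell. After the substitution
  \<open>x = u\<close> these factors combine to those of the first product, because
  \<open>(1 - c u) (1 - (c + w) u) - b u^2 = (1 - (c + 1) u) (1 - (c - b) u)\<close> (\<open>cell_series_at_X\<close>).

  The computation takes place in formal power series in \<open>x\<close> over formal power series in \<open>u\<close>, so that
  \<open>t\<close> and \<open>y\<close> are coefficients while \<open>x\<close> is still a variable with a derivation.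

  Integrality follows from the same description of the symbols: \<open>n\<close> times a coefficient of \<open>V^k\<close> is
  a coefficient of \<open>x d/dx V^k = k x V^{k-1} dV/dx\<close>, hence divisible by \<open>k\<close>.
\<close>

unbundle fps_syntax

section \<open>Ordered decompositions of a vector into nonzero vectors\<close>

text \<open>
  Li Shanlan's identity. Vandermonde splits the last factor on the left as
  \<open>\<Sum>\<^sub>k (p - r choose k) (x + m choose m + p - k)\<close>; the sum over \<open>r\<close> and then the sum over \<open>k\<close> are again
  Vandermonde convolutions.
\<close>

lemma choose_product_expansion:
  fixes p m x :: nat
  shows "(\<Sum>r\<le>p. (p choose r) * (m choose r) * ((x + m + p - r) choose (m + p)))
       = ((x + m) choose m) * ((x + p) choose p)"
proof -
  have inner: "(\<Sum>r\<le>p. (p choose r) * (m choose r) * ((p - r) choose k))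
      = (p choose k) * ((m + p - k) choose m)" if "k \<le> p" for k
  proof -
    have "(\<Sum>r\<le>p. (p choose r) * (m choose r) * ((p - r) choose k))
        = (\<Sum>r\<le>p. (p choose k) * (((p - k) choose r) * (m choose r)))"
    proof (rule sum.cong[OF refl])
      fix r assume "r \<in> {..p}"
      show "(p choose r) * (m choose r) * ((p - r) choose k)
          = (p choose k) * (((p - k) choose r) * (m choose r))"
      proof (cases "r + k \<le> p")
        case True
        have "(p choose r) * ((p - r) choose k) = (p choose (r + k)) * ((r + k) choose r)"
          using choose_mult[of r "r + k" p] True by simp
        moreover have "(p choose k) * ((p - k) choose r) = (p choose (r + k)) * ((r + k) choose k)"
          using choose_mult[of k "r + k" p] True by simp
        moreover have "(r + k) choose r = (r + k) choose k"
          using binomial_symmetric[of r "r + k"] by simp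
        ultimately show ?thesis by (simp add: algebra_simps)
      next
        case False
        then have "p - r < k" "p - k < r" using \<open>r \<in> {..p}\<close> that by auto
        then show ?thesis by (simp add: binomial_eq_0)
      qed
    qed
    also have "\<dots> = (p choose k) * (\<Sum>r\<le>p. ((p - k) choose r) * (m choose r))"
      by (simp add: sum_distrib_left)
    also have "(\<Sum>r\<le>p. ((p - k) choose r) * (m choose r))
        = (\<Sum>r\<le>p - k. ((p - k) choose r) * (m choose r))"
      by (rule sum.mono_neutral_right) (auto simp: binomial_eq_0)
    also have "\<dots> = (\<Sum>r\<le>p - k. (m choose r) * ((p - k) choose (p - k - r)))"
      by (intro sum.cong refl) (simp add: binomial_symmetric[of _ "p - k"])
    also have "\<dots> = (m + (p - k)) choose (p - k)"
      by (rule vandermonde)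
    also have "\<dots> = (m + p - k) choose m"
      using binomial_symmetric[of m "m + p - k"] that by simp
    finally show ?thesis .
  qed
  have "(\<Sum>r\<le>p. (p choose r) * (m choose r) * ((x + m + p - r) choose (m + p)))
      = (\<Sum>r\<le>p. \<Sum>k\<le>p. (p choose r) * (m choose r) * ((p - r) choose k) * ((x + m) choose (m + p - k)))"
  proof (rule sum.cong[OF refl])
    fix r assume r: "r \<in> {..p}"
    have "(x + m + p - r) choose (m + p) = ((p - r) + (x + m)) choose (m + p)"
      using r by (simp add: add.commute)
    also have "\<dots> = (\<Sum>k\<le>m + p. ((p - r) choose k) * ((x + m) choose (m + p - k)))"
      by (rule vandermonde[symmetric])
    also have "\<dots> = (\<Sum>k\<le>p. ((p - r) choose k) * ((x + m) choose (m + p - k)))"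
      by (rule sum.mono_neutral_right) (auto simp: binomial_eq_0)
    finally show "(p choose r) * (m choose r) * ((x + m + p - r) choose (m + p))
       = (\<Sum>k\<le>p. (p choose r) * (m choose r) * ((p - r) choose k) * ((x + m) choose (m + p - k)))"
      by (simp add: sum_distrib_left mult.assoc)
  qed
  also have "\<dots> = (\<Sum>k\<le>p. (p choose k) * ((m + p - k) choose m) * ((x + m) choose (m + p - k)))"
    by (subst sum.swap) (simp add: sum_distrib_right[symmetric] inner)
  also have "\<dots> = (\<Sum>k\<le>p. ((x + m) choose m) * ((p choose k) * (x choose (p - k))))"
  proof (rule sum.cong[OF refl])
    fix k assume k: "k \<in> {..p}"
    show "(p choose k) * ((m + p - k) choose m) * ((x + m) choose (m + p - k))
        = ((x + m) choose m) * ((p choose k) * (x choose (p - k)))"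
    proof (cases "p - k \<le> x")
      case True
      then show ?thesis
        using choose_mult[of m "m + p - k" "x + m"] k by (simp add: algebra_simps)
    next
      case False
      then show ?thesis using k by (simp add: binomial_eq_0)
    qed
  qed
  also have "\<dots> = ((x + m) choose m) * ((p + x) choose p)"
    by (simp add: sum_distrib_left[symmetric] vandermonde)
  finally show ?thesis by (simp add: add.commute)
qed

text \<open>
  The number of ways to write the vector \<open>(n - p, p)\<close> as an ordered sum of \<open>k\<close> nonzero vectors of
  natural numbers (MacMahon's compositions of bipartite numbers). Writing the last binomial
  coefficient with lower index \<open>n - k\<close> instead of \<open>k - r - 1\<close> makes the terms with \<open>k \<le> r\<close> vanish and
  gives the value 1 at \<open>n = p = k = 0\<close>, as the empty sum demands.
\<close>

definition vec_compositions :: "nat \<Rightarrow> nat \<Rightarrow> nat \<Rightarrow> nat" where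
  "vec_compositions n p k =
     (if k \<le> n then \<Sum>r\<le>p. (p choose r) * ((n - p) choose r) * ((n - r - 1) choose (n - k)) else 0)"

text \<open>
  If zero vectors are allowed, \<open>(n - p, p)\<close> is a sum of \<open>j\<close> vectors in as many ways as its two entries
  can be composed separately; choosing which \<open>k\<close> of the \<open>j\<close> vectors are nonzero gives the left-hand
  side. For \<open>j > 0\<close> the proof sums over \<open>k\<close> by Vandermonde, which leaves the expansion of a product of
  two binomial coefficients above.
\<close>

lemma sum_choose_vec_compositions:
  assumes "p \<le> n"
  shows "(\<Sum>k\<le>n. (j choose k) * vec_compositions n p k)
       = ((n - p + j - 1) choose (n - p)) * ((p + j - 1) choose p)"
proof (cases "n = 0")
  case True
  then show ?thesis using assms by (simp add: vec_compositions_def)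
next
  case n: False
  have "(\<Sum>k\<le>n. (j choose k) * vec_compositions n p k)
      = (\<Sum>k\<le>n. \<Sum>r\<le>p. (p choose r) * ((n - p) choose r) * ((j choose k) * ((n - r - 1) choose (n - k))))"
    by (intro sum.cong refl) (simp add: vec_compositions_def sum_distrib_left mult_ac)
  also have "\<dots> = (\<Sum>r\<le>p. (p choose r) * ((n - p) choose r) * ((j + (n - r - 1)) choose n))"
    by (subst sum.swap) (simp add: sum_distrib_left[symmetric] vandermonde)
  also have "\<dots> = ((n - p + j - 1) choose (n - p)) * ((p + j - 1) choose p)"
  proof (cases j)
    case 0
    have "n - p - 1 < n - p \<or> p - 1 < p"
      using n assms by auto
    then show ?thesis using 0 n by (auto simp: binomial_eq_0)
  next
    case (Suc x)
    have "(\<Sum>r\<le>p. (p choose r) * ((n - p) choose r) * ((j + (n - r - 1)) choose n))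
        = (\<Sum>r\<le>p. (p choose r) * ((n - p) choose r) * ((x + (n - p) + p - r) choose ((n - p) + p)))"
    proof (rule sum.cong[OF refl])
      fix r assume "r \<in> {..p}"
      show "(p choose r) * ((n - p) choose r) * ((j + (n - r - 1)) choose n)
          = (p choose r) * ((n - p) choose r) * ((x + (n - p) + p - r) choose ((n - p) + p))"
      proof (cases "r < n")
        case True
        then have "j + (n - r - 1) = x + n - r" using Suc by simp
        then show ?thesis using assms by simp
      next
        case False
        then have "r = n" "p = n" using \<open>r \<in> {..p}\<close> assms by auto
        then show ?thesis using n by simp
      qed
    qed
    also have "\<dots> = ((x + (n - p)) choose (n - p)) * ((x + p) choose p)"
      by (rule choose_product_expansion)
    finally show ?thesis using Suc by (simp add: add.commute)
  qed
  finally show ?thesis .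
qed

text \<open>
  The expansion of \<open>1 / (1 - t x)^j\<close>. It is given by its coefficients since the coefficient ring has
  no division; \<open>inv_power_series_1\<close> and \<open>inv_power_series_power\<close> justify the reading.
\<close>

definition inv_power_series :: "nat \<Rightarrow> 'a::comm_ring_1 \<Rightarrow> 'a fps" where
  "inv_power_series j t = Abs_fps (\<lambda>n. of_nat ((n + j - 1) choose n) * t ^ n)"

lemma inv_power_series_0 [simp]: "inv_power_series 0 t = 1"
proof (rule fps_ext)
  fix n show "inv_power_series 0 t $ n = (1 :: 'a fps) $ n"
    by (cases n) (simp_all add: inv_power_series_def binomial_eq_0)
qed

lemma inv_power_series_nth_0 [simp]: "inv_power_series j t $ 0 = 1"
  by (simp add: inv_power_series_def)

lemma inv_power_series_Suc_times:
  "inv_power_series (Suc j) t * (1 - fps_const t * fps_X) = inv_power_series j t"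
proof (rule fps_ext)
  fix n
  show "(inv_power_series (Suc j) t * (1 - fps_const t * fps_X)) $ n = inv_power_series j t $ n"
  proof (cases n)
    case (Suc m)
    have "(Suc (m + j)) choose (Suc m) = ((m + j) choose m) + ((m + j) choose (Suc m))"
      by simp
    then show ?thesis
      by (simp add: Suc inv_power_series_def algebra_simps)
  qed (simp add: inv_power_series_def)
qed

lemma inv_power_series_1: "inv_power_series 1 t * (1 - fps_const t * fps_X) = 1"
  using inv_power_series_Suc_times[of 0 t] by simp

lemma inv_power_series_power: "inv_power_series j t = inv_power_series 1 t ^ j"
proof (induction j)
  case (Suc j)
  have "inv_power_series (Suc j) t
      = inv_power_series (Suc j) t * (1 - fps_const t * fps_X) * inv_power_series 1 t"
    by (simp only: mult.assoc inv_power_series_1 mult.commute[of "1 - fps_const t * fps_X"] mult_1_right)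
  also have "\<dots> = inv_power_series 1 t ^ j * inv_power_series 1 t"
    by (simp only: inv_power_series_Suc_times Suc)
  finally show ?case by (simp add: mult.commute)
qed simp

text \<open>
  The series \<open>1 / ((1 - x) (1 - t x)) - 1\<close>, in which every nonzero vector \<open>(a, b)\<close> contributes
  \<open>x^(a + b) t^b\<close>.
\<close>

definition vec_series :: "'a::comm_ring_1 \<Rightarrow> 'a fps" where
  "vec_series t = inv_power_series 1 1 * inv_power_series 1 t - 1"

lemma vec_series_nth_0 [simp]: "vec_series t $ 0 = 0"
  by (simp add: vec_series_def)

lemma vec_series_eq:
  "(vec_series t + 1) * ((1 - fps_X) * (1 - fps_const t * fps_X)) = 1"
proof -
  have "(vec_series t + 1) * ((1 - fps_X) * (1 - fps_const t * fps_X))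
      = (inv_power_series 1 1 * (1 - fps_X)) * (inv_power_series 1 t * (1 - fps_const t * fps_X))"
    by (simp only: vec_series_def diff_add_cancel mult_ac)
  then show ?thesis
    using inv_power_series_1[of "1::'a"] by (simp add: inv_power_series_1[simplified])
qed

text \<open>
  A binomial inversion. The powers of \<open>vec_series t + 1\<close> have product-form coefficients, and
  \<open>sum_choose_vec_compositions\<close> expands these with the same binomial weights as the binomial theorem
  expands \<open>(vec_series t + 1) ^ j\<close>. The weights are triangular with ones on the diagonal, so the
  expanded quantities agree.
\<close>

lemma vec_series_power_nth:
  "(vec_series t ^ k) $ n = (\<Sum>p\<le>n. of_nat (vec_compositions n p k) * t ^ p)"
proof -
  define W where "W k = Abs_fps (\<lambda>n. \<Sum>p\<le>n. of_nat (vec_compositions n p k) * t ^ p)" for k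
  have pow: "(vec_series t + 1) ^ j = (\<Sum>k\<le>j. of_nat (j choose k) * vec_series t ^ k)" for j
    by (simp add: binomial_ring)
  have W_sum: "(vec_series t + 1) ^ j = (\<Sum>k\<le>j. of_nat (j choose k) * W k)" for j
  proof (rule fps_ext)
    fix n
    have "((vec_series t + 1) ^ j) $ n = (inv_power_series j t * inv_power_series j 1) $ n"
      by (simp add: vec_series_def power_mult_distrib mult.commute
            inv_power_series_power[of j t] inv_power_series_power[of j 1])
    also have "\<dots> = (\<Sum>p\<le>n. of_nat (((n - p + j - 1) choose (n - p)) * ((p + j - 1) choose p)) * t ^ p)"
      unfolding fps_mult_nth by (simp add: inv_power_series_def atMost_atLeast0 mult_ac)
    also have "\<dots> = (\<Sum>p\<le>n. (\<Sum>k\<le>n. of_nat ((j choose k) * vec_compositions n p k)) * t ^ p)"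
      by (intro sum.cong refl arg_cong2[of _ _ _ _ "(*)"])
         (simp only: of_nat_sum[symmetric] sum_choose_vec_compositions atMost_iff)
    also have "\<dots> = (\<Sum>k\<le>n. of_nat (j choose k) * W k $ n)"
      by (simp add: sum_distrib_right sum_distrib_left W_def mult.assoc) (rule sum.swap)
    also have "\<dots> = (\<Sum>k\<le>max j n. of_nat (j choose k) * W k $ n)"
      by (rule sum.mono_neutral_left) (auto simp: W_def vec_compositions_def)
    also have "\<dots> = (\<Sum>k\<le>j. of_nat (j choose k) * W k $ n)"
      by (rule sum.mono_neutral_right) (auto simp: binomial_eq_0)
    also have "\<dots> = (\<Sum>k\<le>j. of_nat (j choose k) * W k) $ n"
      by (simp add: fps_sum_nth fps_mult_of_nat_nth)
    finally show "((vec_series t + 1) ^ j) $ n = (\<Sum>k\<le>j. of_nat (j choose k) * W k) $ n" .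
  qed
  have "W k = vec_series t ^ k"
  proof (induction k rule: less_induct)
    case (less k)
    have "(\<Sum>i<k. of_nat (k choose i) * W i) = (\<Sum>i<k. of_nat (k choose i) * vec_series t ^ i)"
      using less by simp
    moreover have "(\<Sum>i\<le>k. of_nat (k choose i) * W i) = (\<Sum>i\<le>k. of_nat (k choose i) * vec_series t ^ i)"
      using pow W_sum by metis
    ultimately show ?case
      unfolding lessThan_Suc_atMost[symmetric] by simp
  qed
  then have "(vec_series t ^ k) $ n = W k $ n" by simp
  then show ?thesis by (simp add: W_def)
qed

text \<open>
  Differentiation of a \<open>k\<close>-th power yields a factor \<open>k\<close>. The parameter \<open>t\<close> is taken to be a variable over
  the integers, which separates the coefficients of its powers.
\<close>

lemma dvd_vec_compositions: "k dvd n * vec_compositions n p k" if "1 \<le> k" "p \<le> n"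
proof (cases n)
  case (Suc m)
  define t where "t = (fps_X :: int fps)"
  have "fps_deriv (vec_series t ^ k) $ m = of_nat n * (vec_series t ^ k) $ n"
    by (simp add: Suc)
  also have "\<dots> $ p = int (n * vec_compositions n p k)"
    using that by (simp add: vec_series_power_nth t_def fps_sum_nth fps_mult_of_nat_nth
        fps_X_power_nth if_distrib cong: if_cong)
  finally have 1: "fps_deriv (vec_series t ^ k) $ m $ p = int (n * vec_compositions n p k)" .
  have "fps_deriv (vec_series t ^ k) = of_nat k * (fps_deriv (vec_series t) * vec_series t ^ (k - 1))"
    by (simp add: fps_deriv_power fps_of_nat mult.assoc)
  then have "fps_deriv (vec_series t ^ k) $ m $ p
      = int k * (fps_deriv (vec_series t) * vec_series t ^ (k - 1)) $ m $ p"
    by (simp only: fps_mult_of_nat_nth)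
  then show ?thesis using 1 by (metis dvd_triv_left of_nat_dvd_iff)
qed simp

section \<open>The exponential formula over partitions\<close>

lemma fps_const_sum: "fps_const (sum f A) = (\<Sum>a\<in>A. fps_const (f a))"
  by (induction A rule: infinite_finite_induct) (simp_all flip: fps_const_add)

lemma partitions_of_0: "partitions_of 0 = {[]}"
  by (auto simp: partitions_of_def is_partition_def) (metis list.set_intros(1) less_irrefl neq_Nil_conv)

lemma finite_partitions_of: "finite (partitions_of n)"
proof (rule finite_subset)
  show "partitions_of n \<subseteq> {xs. set xs \<subseteq> {..n} \<and> length xs \<le> n}"
  proof
    fix xs assume xs: "xs \<in> partitions_of n"
    then have "\<forall>x\<in>set xs. 1 \<le> x" and n: "sum_list xs = n"
      by (auto simp: partitions_of_def is_partition_def Suc_leI)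
    then have "sum_list (map (\<lambda>_. 1) xs) \<le> sum_list (map (\<lambda>x. x) xs)"
      by (intro sum_list_mono) auto
    then have "length xs \<le> n" using n by (simp add: sum_list_triv)
    then show "xs \<in> {xs. set xs \<subseteq> {..n} \<and> length xs \<le> n}"
      using n member_le_sum_list by auto
  qed
qed (rule finite_lists_length_le, simp)

text \<open>
  Partitions are decreasing lists, hence determined by their multisets of parts. This allows parts to
  be inserted and removed without regard to their position.
\<close>

lemma partition_eqI:
  assumes "is_partition \<mu>" "is_partition \<nu>" "mset \<mu> = mset \<nu>"
  shows "\<mu> = \<nu>"
proof -
  have "sorted (rev \<mu>)" "sorted (rev \<nu>)"
    using assms by (simp_all add: is_partition_def sorted_wrt_rev)
  then have "rev \<mu> = rev \<nu>"
    using assms(3) properties_for_sort by (metis mset_rev)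
  then show ?thesis by simp
qed

definition add_part :: "nat \<Rightarrow> nat list \<Rightarrow> nat list" where
  "add_part i \<nu> = rev (insort i (rev \<nu>))"

lemma mset_add_part [simp]: "mset (add_part i \<nu>) = add_mset i (mset \<nu>)"
  by (simp add: add_part_def)

lemma is_partition_add_part: "is_partition \<nu> \<Longrightarrow> 0 < i \<Longrightarrow> is_partition (add_part i \<nu>)"
  by (auto simp: is_partition_def add_part_def sorted_wrt_rev sorted_insort set_insort_key)

lemma sorted_wrt_remove1: "sorted_wrt P xs \<Longrightarrow> sorted_wrt P (remove1 a xs)"
  by (induction xs) (auto dest: subsetD[OF set_remove1_subset])

lemma is_partition_remove1: "is_partition \<mu> \<Longrightarrow> is_partition (remove1 i \<mu>)"
  using set_remove1_subset[of i \<mu>]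
  by (auto simp: is_partition_def sorted_wrt_remove1)

lemma zee_remove1:
  assumes "i \<in> set \<mu>"
  shows "zee \<mu> = i * count_list \<mu> i * zee (remove1 i \<mu>)"
proof -
  let ?c = "count_list \<mu>" and ?c' = "count_list (remove1 i \<mu>)"
  have c': "?c' x = (if x = i then ?c i - 1 else ?c x)" for x
    by (simp flip: count_mset)
  have pos: "0 < ?c i" using assms by (metis count_list_0_iff gr0I)
  have "zee (remove1 i \<mu>) = (\<Prod>x\<in>set \<mu>. x ^ ?c' x * fact (?c' x))"
    unfolding zee_def
  proof (rule prod.mono_neutral_left)
    show "\<forall>x\<in>set \<mu> - set (remove1 i \<mu>). x ^ ?c' x * fact (?c' x) = 1"
    proof
      fix x assume "x \<in> set \<mu> - set (remove1 i \<mu>)"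
      then have "?c' x = 0" unfolding count_list_0_iff by blast
      then show "x ^ ?c' x * fact (?c' x) = 1" by (simp only: power_0 fact_0 mult_1_right)
    qed
  qed (simp_all add: set_remove1_subset)
  also have "\<dots> = i ^ (?c i - 1) * fact (?c i - 1) * (\<Prod>x\<in>set \<mu> - {i}. x ^ ?c x * fact (?c x))"
    using assms by (subst prod.remove[of _ i]) (auto simp: c' intro!: prod.cong)
  finally have "zee (remove1 i \<mu>)
      = i ^ (?c i - 1) * fact (?c i - 1) * (\<Prod>x\<in>set \<mu> - {i}. x ^ ?c x * fact (?c x))" .
  moreover have "zee \<mu> = i ^ ?c i * fact (?c i) * (\<Prod>x\<in>set \<mu> - {i}. x ^ ?c x * fact (?c x))"
    using assms unfolding zee_def by (subst prod.remove[of _ i]) auto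
  moreover have "i ^ ?c i * fact (?c i) = i * ?c i * (i ^ (?c i - 1) * (fact (?c i - 1) :: nat))"
    using pos by (cases "?c i") (auto simp: algebra_simps)
  ultimately show ?thesis by (simp add: mult.assoc)
qed

lemma zee_pos: "is_partition \<mu> \<Longrightarrow> 0 < zee \<mu>"
  unfolding zee_def is_partition_def by (intro prod_pos) auto

text \<open>
  The summand that a partition contributes to the coefficient of \<open>x^n\<close> in \<open>exp (\<Sum>\<^sub>i f i x^i / i)\<close>.
\<close>

definition partition_weight :: "(nat \<Rightarrow> real fps) \<Rightarrow> nat list \<Rightarrow> real fps" where
  "partition_weight f \<mu> = fps_const (1 / real (zee \<mu>)) * prod_list (map f \<mu>)"

lemma partition_weight_remove1:
  assumes "is_partition \<mu>" "i \<in> set \<mu>"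
  shows "of_nat (i * count_list \<mu> i) * partition_weight f \<mu> = f i * partition_weight f (remove1 i \<mu>)"
proof -
  have pos: "0 < zee \<mu>" "0 < zee (remove1 i \<mu>)"
    using assms by (auto intro: zee_pos is_partition_remove1)
  have "prod_list (map f \<mu>) = prod_mset (image_mset f (mset \<mu>))"
    by (simp flip: prod_mset_prod_list)
  also have "mset \<mu> = add_mset i (mset (remove1 i \<mu>))"
    using assms by simp
  also have "prod_mset (image_mset f \<dots>) = f i * prod_list (map f (remove1 i \<mu>))"
    by (simp flip: prod_mset_prod_list)
  finally have *: "prod_list (map f \<mu>) = f i * prod_list (map f (remove1 i \<mu>))" .
  have "real (i * count_list \<mu> i) * (1 / real (zee \<mu>)) = 1 / real (zee (remove1 i \<mu>))"
    using pos zee_remove1[OF assms(2)] by (auto simp: field_simps)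
  then have "of_nat (i * count_list \<mu> i) * fps_const (1 / real (zee \<mu>))
       = fps_const (1 / real (zee (remove1 i \<mu>)))"
    by (simp only: fps_of_nat[symmetric] fps_const_mult)
  then show ?thesis
    unfolding partition_weight_def * by (simp add: mult_ac)
qed

text \<open>
  The exponential formula in differential form: with \<open>H\<close> the generating function of the inner sums it
  says \<open>x dH/dx = (\<Sum>\<^sub>i f i x^i) H\<close>. Counting every part \<open>i\<close> of \<open>\<mu>\<close> with its size gives the factor \<open>n\<close>,
  and removing one part \<open>i\<close> divides \<open>z\<^sub>\<mu>\<close> by \<open>i\<close> times its multiplicity.
\<close>

lemma partition_weight_recurrence:
  "of_nat n * (\<Sum>\<mu>\<in>partitions_of n. partition_weight f \<mu>)
     = (\<Sum>i=1..n. f i * (\<Sum>\<nu>\<in>partitions_of (n - i). partition_weight f \<nu>))"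
proof -
  have "of_nat n * (\<Sum>\<mu>\<in>partitions_of n. partition_weight f \<mu>)
      = (\<Sum>\<mu>\<in>partitions_of n. \<Sum>i\<in>set \<mu>. f i * partition_weight f (remove1 i \<mu>))"
    unfolding sum_distrib_left
  proof (rule sum.cong[OF refl])
    fix \<mu> assume \<mu>: "\<mu> \<in> partitions_of n"
    then have "n = sum_list (map (\<lambda>x. x) \<mu>)" by (simp add: partitions_of_def)
    also have "\<dots> = (\<Sum>i\<in>set \<mu>. count_list \<mu> i * i)"
      by (rule sum_list_map_eq_sum_count)
    finally have n: "n = (\<Sum>i\<in>set \<mu>. i * count_list \<mu> i)" by (simp add: mult.commute)
    show "of_nat n * partition_weight f \<mu> = (\<Sum>i\<in>set \<mu>. f i * partition_weight f (remove1 i \<mu>))"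
      using \<mu> partition_weight_remove1[of \<mu> _ f]
      by (subst n) (simp add: partitions_of_def sum_distrib_right)
  qed
  also have "\<dots> = (\<Sum>(\<mu>, i)\<in>Sigma (partitions_of n) set. f i * partition_weight f (remove1 i \<mu>))"
    by (rule sum.Sigma) (auto simp: finite_partitions_of)
  also have "\<dots> = (\<Sum>(i, \<nu>)\<in>Sigma {1..n} (\<lambda>i. partitions_of (n - i)). f i * partition_weight f \<nu>)"
  proof (rule sum.reindex_bij_witness[where i = "\<lambda>(i, \<nu>). (add_part i \<nu>, i)" and j = "\<lambda>(\<mu>, i). (i, remove1 i \<mu>)"];
         clarsimp simp: partitions_of_def)
    fix \<mu> i assume *: "is_partition \<mu>" "i \<in> set \<mu>" "n = sum_list \<mu>"
    then show "add_part i (remove1 i \<mu>) = \<mu>"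
      by (intro partition_eqI is_partition_add_part is_partition_remove1) (auto simp: is_partition_def)
    have "sum_list \<mu> = i + sum_list (remove1 i \<mu>)"
      using * sum_list_map_remove1[of i \<mu> "\<lambda>x. x"] by simp
    then show "Suc 0 \<le> i \<and> i \<le> sum_list \<mu> \<and> is_partition (remove1 i \<mu>) \<and> sum_list (remove1 i \<mu>) = sum_list \<mu> - i"
      using * is_partition_remove1[of \<mu> i] by (auto simp: is_partition_def Suc_leI)
  next
    fix i \<nu> assume *: "Suc 0 \<le> i" "i \<le> n" "is_partition \<nu>" "sum_list \<nu> = n - i"
    then have P: "is_partition (add_part i \<nu>)" by (intro is_partition_add_part) auto
    show "remove1 i (add_part i \<nu>) = \<nu>"
      using * P by (intro partition_eqI is_partition_remove1) auto
    have "sum_list (add_part i \<nu>) = n"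
      using * by (simp flip: sum_mset_sum_list)
    moreover have "i \<in> set (add_part i \<nu>)" by (simp flip: set_mset_mset)
    ultimately show "is_partition (add_part i \<nu>) \<and> sum_list (add_part i \<nu>) = n \<and> i \<in> set (add_part i \<nu>)"
      using P by simp
  qed
  also have "\<dots> = (\<Sum>i=1..n. f i * (\<Sum>\<nu>\<in>partitions_of (n - i). partition_weight f \<nu>))"
    by (simp add: sum.Sigma[symmetric] finite_partitions_of sum_distrib_left)
  finally show ?thesis .
qed


section \<open>Generating function of the bracket symbols\<close>

lemma gbinom_eq:
  assumes "1 \<le> n" "p \<le> n"
  shows "gbinom n p k = real n / real k * real (vec_compositions n p k)"
proof (cases "k = 0")
  case False
  have "binom (real p) (int r) * binom (real n - real p) (int r) * binom (real n - real r - 1) (int k - int r - 1)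
      = (if k \<le> n then real ((p choose r) * ((n - p) choose r) * ((n - r - 1) choose (n - k))) else 0)"
    if r: "r \<le> p" for r
  proof (cases "r = n")
    case True
    then have "(n - p) choose r = 0" using assms r by simp
    moreover have "binom (real n - real p) (int r) = real ((n - p) choose r)"
      using assms by (simp add: binom_def binomial_gbinomial of_nat_diff)
    ultimately show ?thesis by simp
  next
    case False
    then have rn: "r < n" using r assms by simp
    have 1: "binom (real p) (int r) = real (p choose r)"
      by (simp add: binom_def binomial_gbinomial)
    have 2: "binom (real n - real p) (int r) = real ((n - p) choose r)"
      using assms by (simp add: binom_def binomial_gbinomial of_nat_diff)
    have nr: "real n - real r - 1 = real (n - r - 1)" using rn by (simp add: of_nat_diff)
    have 3: "binom (real n - real r - 1) (int k - int r - 1)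
        = (if r < k then real ((n - r - 1) choose (k - r - 1)) else 0)"
      unfolding nr binom_def binomial_gbinomial using rn
      by (auto simp: nat_diff_distrib simp del: of_nat_diff)
    have "(if r < k then (n - r - 1) choose (k - r - 1) else 0)
        = (if k \<le> n then (n - r - 1) choose (n - k) else 0)"
    proof (cases "r < k \<and> k \<le> n")
      case True
      then have "k - r - 1 \<le> n - r - 1" "n - r - 1 - (k - r - 1) = n - k" by auto
      then show ?thesis using True binomial_symmetric[of "k - r - 1" "n - r - 1"] by simp
    next
      case False
      then show ?thesis using rn by (auto simp: binomial_eq_0)
    qed
    then show ?thesis by (simp add: 1 2 3 split: if_splits)
  qed
  then have "(\<Sum>r\<le>p. binom (real p) (int r) * binom (real n - real p) (int r) * binom (real n - real r - 1) (int k - int r - 1))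
     = real (vec_compositions n p k)"
    by (simp add: vec_compositions_def)
  then show ?thesis by (simp add: gbinom_def)
qed (simp add: gbinom_def)

lemma k_decomps_0: "k_decomps \<mu> 0 = (if \<mu> = [] then {[]} else {})"
  by (auto simp: k_decomps_def neq_Nil_conv length_Suc_conv)

text \<open>
  At \<open>k = 0\<close> the convention for the symbol agrees with the sum over decompositions: only the empty
  partition has a decomposition of 0 into positive numbers.
\<close>

lemma gsymb_eq:
  "gsymb \<mu> p k = (\<Sum>ps\<in>p_decomps \<mu> p. \<Sum>ks\<in>k_decomps \<mu> k.
     \<Prod>i<length \<mu>. gbinom (\<mu> ! i) (ps ! i) (ks ! i))"
proof -
  have "p_decomps [] p = (if p = 0 then {[]} else {})" for p
    by (auto simp: p_decomps_def)
  then show ?thesis by (simp add: gsymb_def k_decomps_0)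
qed

lemma finite_p_decomps: "finite (p_decomps \<mu> p)"
  by (rule finite_subset[OF _ finite_lists_length_eq[of "{..p}" "length \<mu>"]])
     (auto simp: p_decomps_def member_le_sum_list)

lemma finite_k_decomps: "finite (k_decomps \<mu> k)"
  by (rule finite_subset[OF _ finite_lists_length_eq[of "{..k}" "length \<mu>"]])
     (auto simp: k_decomps_def member_le_sum_list)

text \<open>
  The bracket symbol sums over lists of choices, one for each part; such lists play the role of
  dependent functions in the distributive law for a product of sums.
\<close>

definition choice_lists :: "nat \<Rightarrow> (nat \<Rightarrow> nat set) \<Rightarrow> nat list set" where
  "choice_lists n A = {xs. length xs = n \<and> (\<forall>i<n. xs ! i \<in> A i)}"

lemma bij_choice_lists:
  "bij_betw (\<lambda>g. map g [0..<n]) (PiE {..<n} A) (choice_lists n A)"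
  by (rule bij_betw_byWitness[where f' = "\<lambda>xs. restrict (\<lambda>i. xs ! i) {..<n}"])
     (auto simp: choice_lists_def PiE_def extensional_def fun_eq_iff intro: nth_equalityI)

lemma finite_choice_lists: "(\<And>i. finite (A i)) \<Longrightarrow> finite (choice_lists n A)"
  using bij_betw_finite[OF bij_choice_lists[of n A]] finite_PiE[of "{..<n}" A] by simp

lemma prod_sum_choice_lists:
  fixes \<phi> :: "nat \<Rightarrow> nat \<Rightarrow> 'a::comm_semiring_1"
  assumes "\<And>i. finite (A i)"
  shows "(\<Prod>i<n. \<Sum>x\<in>A i. \<phi> i x) = (\<Sum>xs\<in>choice_lists n A. \<Prod>i<n. \<phi> i (xs ! i))"
proof -
  have "(\<Prod>i<n. \<Sum>x\<in>A i. \<phi> i x) = (\<Sum>g\<in>PiE {..<n} A. \<Prod>i<n. \<phi> i (g i))"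
    using assms by (intro prod_sum_PiE) auto
  also have "\<dots> = (\<Sum>g\<in>PiE {..<n} A. \<Prod>i<n. \<phi> i (map g [0..<n] ! i))"
    by simp
  also have "\<dots> = (\<Sum>xs\<in>choice_lists n A. \<Prod>i<n. \<phi> i (xs ! i))"
    by (rule sum.reindex_bij_betw[OF bij_choice_lists])
  finally show ?thesis .
qed

text \<open>
  The generating function of the one-part symbols. Its arguments \<open>T\<close> and \<open>Y\<close> are themselves power
  series in \<open>u\<close>, to be specialised to \<open>1 / (1 - w u)\<close> and \<open>Z / (1 - Z)\<close>.
\<close>

definition part_series :: "real fps \<Rightarrow> real fps \<Rightarrow> nat \<Rightarrow> real fps" where
  "part_series T Y n = (\<Sum>p\<le>n. \<Sum>k=1..n. fps_const (gbinom n p k) * T ^ p * Y ^ k)"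

text \<open>
  Multiplicativity over the parts. The decompositions of \<open>k\<close> are not bounded by the parts, but a choice
  \<open>k\<^sub>i > \<mu>\<^sub>i\<close> has coefficient zero, so the bounded choices suffice.
\<close>

lemma gsymb_series:
  assumes "is_partition \<mu>"
  shows "(\<Sum>p\<le>sum_list \<mu>. \<Sum>k\<le>sum_list \<mu>. fps_const (gsymb \<mu> p k) * T ^ p * Y ^ k)
       = prod_list (map (part_series T Y) \<mu>)"
proof -
  define N where "N = length \<mu>"
  define M where "M = sum_list \<mu>"
  define PS where "PS = choice_lists N (\<lambda>i. {..\<mu> ! i})"
  define KS where "KS = choice_lists N (\<lambda>i. {1..\<mu> ! i})"
  define \<Theta> where "\<Theta> ps ks = (\<Prod>i<N. fps_const (gbinom (\<mu> ! i) (ps ! i) (ks ! i)) * T ^ (ps ! i) * Y ^ (ks ! i))" for ps ks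
  have fin: "finite PS" "finite KS" by (simp_all add: PS_def KS_def finite_choice_lists)
  have sum_nth: "sum_list xs = (\<Sum>i<N. xs ! i)" if "length xs = N" for xs :: "nat list"
    using that by (simp add: sum_list_sum_nth atLeast0LessThan)
  have \<Theta>: "\<Theta> ps ks = fps_const (\<Prod>i<N. gbinom (\<mu> ! i) (ps ! i) (ks ! i)) * T ^ sum_list ps * Y ^ sum_list ks"
    if "length ps = N" "length ks = N" for ps ks
  proof -
    have "fps_const (\<Prod>i<n. x i) = (\<Prod>i<n. fps_const (x i))" for n and x :: "nat \<Rightarrow> real"
      by (induction n) (simp_all flip: fps_const_mult)
    then show ?thesis
      by (simp add: \<Theta>_def prod.distrib power_sum sum_nth that)
  qed
  have PS_sum: "{ps \<in> PS. sum_list ps = p} = p_decomps \<mu> p" for p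
    by (auto simp: PS_def choice_lists_def p_decomps_def N_def)
  have le_M: "sum_list xs \<le> M" if "length xs = N" "\<forall>i<N. xs ! i \<le> \<mu> ! i" for xs
    using that by (simp add: M_def sum_nth N_def) (auto intro: sum_mono simp: sum_list_sum_nth atLeast0LessThan)
  have inner: "(\<Sum>k\<le>M. \<Sum>ks\<in>k_decomps \<mu> k. \<Theta> ps ks) = (\<Sum>ks\<in>KS. \<Theta> ps ks)" if ps: "ps \<in> PS" for ps
  proof -
    have "(\<Sum>ks\<in>k_decomps \<mu> k. \<Theta> ps ks) = (\<Sum>ks | ks \<in> KS \<and> sum_list ks = k. \<Theta> ps ks)" for k
    proof (rule sum.mono_neutral_right)
      show "{ks. ks \<in> KS \<and> sum_list ks = k} \<subseteq> k_decomps \<mu> k"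
        by (auto simp: KS_def choice_lists_def k_decomps_def N_def in_set_conv_nth)
      show "\<forall>ks\<in>k_decomps \<mu> k - {ks \<in> KS. sum_list ks = k}. \<Theta> ps ks = 0"
      proof
        fix ks assume ks: "ks \<in> k_decomps \<mu> k - {ks \<in> KS. sum_list ks = k}"
        then obtain i where i: "i < N" "\<not> ks ! i \<le> \<mu> ! i"
          by (fastforce simp: KS_def choice_lists_def k_decomps_def N_def)
        moreover have "1 \<le> \<mu> ! i" "ps ! i \<le> \<mu> ! i"
          using assms i ps by (auto simp: is_partition_def N_def PS_def choice_lists_def Suc_leI)
        ultimately have "gbinom (\<mu> ! i) (ps ! i) (ks ! i) = 0"
          by (simp add: gbinom_eq vec_compositions_def)
        then show "\<Theta> ps ks = 0"
          unfolding \<Theta>_def using i by (intro prod_zero) auto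
      qed
    qed (rule finite_k_decomps)
    then have "(\<Sum>k\<le>M. \<Sum>ks\<in>k_decomps \<mu> k. \<Theta> ps ks)
        = (\<Sum>k\<le>M. \<Sum>ks | ks \<in> KS \<and> sum_list ks = k. \<Theta> ps ks)" by simp
    also have "\<dots> = (\<Sum>ks\<in>KS. \<Theta> ps ks)"
      by (rule sum.group[OF fin(2) finite_atMost]) (auto simp: KS_def choice_lists_def intro!: le_M)
    finally show ?thesis .
  qed
  have "(\<Sum>p\<le>M. \<Sum>k\<le>M. fps_const (gsymb \<mu> p k) * T ^ p * Y ^ k)
      = (\<Sum>p\<le>M. \<Sum>k\<le>M. \<Sum>ps\<in>p_decomps \<mu> p. \<Sum>ks\<in>k_decomps \<mu> k. \<Theta> ps ks)"
  proof (intro sum.cong refl)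
    fix p k
    show "fps_const (gsymb \<mu> p k) * T ^ p * Y ^ k = (\<Sum>ps\<in>p_decomps \<mu> p. \<Sum>ks\<in>k_decomps \<mu> k. \<Theta> ps ks)"
      unfolding gsymb_eq fps_const_sum sum_distrib_right
      by (intro sum.cong refl, subst \<Theta>) (auto simp: p_decomps_def k_decomps_def N_def)
  qed
  also have "\<dots> = (\<Sum>p\<le>M. \<Sum>ps\<in>p_decomps \<mu> p. \<Sum>k\<le>M. \<Sum>ks\<in>k_decomps \<mu> k. \<Theta> ps ks)"
    by (intro sum.cong refl sum.swap)
  also have "\<dots> = (\<Sum>p\<le>M. \<Sum>ps | ps \<in> PS \<and> sum_list ps = p. \<Sum>ks\<in>KS. \<Theta> ps ks)"
    by (intro sum.cong refl) (auto simp: PS_sum[symmetric] inner)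
  also have "\<dots> = (\<Sum>ps\<in>PS. \<Sum>ks\<in>KS. \<Theta> ps ks)"
    by (rule sum.group[OF fin(1) finite_atMost]) (auto simp: PS_def choice_lists_def intro!: le_M)
  also have "\<dots> = (\<Prod>i<N. part_series T Y (\<mu> ! i))"
    unfolding part_series_def \<Theta>_def KS_def PS_def
    by (simp only: prod_sum_choice_lists finite_atMost finite_atLeastAtMost)
  also have "\<dots> = prod_list (map (part_series T Y) \<mu>)"
    by (simp add: prod.list_conv_set_nth N_def atLeast0LessThan)
  finally show ?thesis by (simp add: M_def)
qed

lemma F_fun_eq:
  "F_fun \<alpha> n p k l = (\<Sum>\<mu>\<in>partitions_of n. 1 / real (zee \<mu>) * gsymb \<mu> p k * d_part \<alpha> \<mu> l)"
proof (cases "k = 0")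
  case True
  show ?thesis
  proof (cases "n = 0")
    case n: True
    show ?thesis using True n by (simp add: partitions_of_0 F_fun_def gsymb_def zee_def d_part_def)
  next
    case False
    then have "gsymb \<mu> p k = 0" if "\<mu> \<in> partitions_of n" for \<mu>
      using True that by (auto simp: gsymb_def partitions_of_def)
    then show ?thesis using True False by (simp add: F_fun_def)
  qed
qed (simp add: F_fun_def)

text \<open>
  The functions \<open>F\<close> become a sum over partitions of a single multiplicative weight, the form to which
  the exponential formula applies.
\<close>

lemma F_fun_series:
  "(\<Sum>q\<le>m. \<Sum>k\<le>m. fps_const (F_fun \<alpha> m q k l) * T ^ q * Y ^ k)
     = (\<Sum>\<mu>\<in>partitions_of m. partition_weight (\<lambda>i. part_series T Y i * fps_const (d_pow \<alpha> i l)) \<mu>)"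
proof -
  have d_part: "fps_const (d_part \<alpha> \<mu> l) = prod_list (map (\<lambda>i. fps_const (d_pow \<alpha> i l)) \<mu>)" for \<mu>
  proof -
    have "d_part \<alpha> \<mu> l = prod_mset (image_mset (\<lambda>i. d_pow \<alpha> i l) (mset \<mu>))"
      by (simp add: d_part_def image_prod_mset_multiplicity count_mset)
    also have "\<dots> = prod_list (map (\<lambda>i. d_pow \<alpha> i l) \<mu>)"
      by (simp flip: prod_mset_prod_list)
    also have "fps_const \<dots> = prod_list (map (\<lambda>i. fps_const (d_pow \<alpha> i l)) \<mu>)"
      by (induction \<mu>) (simp_all flip: fps_const_mult)
    finally show ?thesis .
  qed
  have "(\<Sum>q\<le>m. \<Sum>k\<le>m. fps_const (F_fun \<alpha> m q k l) * T ^ q * Y ^ k)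
      = (\<Sum>q\<le>m. \<Sum>k\<le>m. \<Sum>\<mu>\<in>partitions_of m.
           fps_const (1 / real (zee \<mu>)) * fps_const (d_part \<alpha> \<mu> l) * (fps_const (gsymb \<mu> q k) * T ^ q * Y ^ k))"
    unfolding F_fun_eq fps_const_sum sum_distrib_right
    by (intro sum.cong refl) (simp only: fps_const_mult[symmetric] mult_ac)
  also have "\<dots> = (\<Sum>q\<le>m. \<Sum>\<mu>\<in>partitions_of m. \<Sum>k\<le>m.
           fps_const (1 / real (zee \<mu>)) * fps_const (d_part \<alpha> \<mu> l) * (fps_const (gsymb \<mu> q k) * T ^ q * Y ^ k))"
    by (intro sum.cong refl sum.swap)
  also have "\<dots> = (\<Sum>\<mu>\<in>partitions_of m. fps_const (1 / real (zee \<mu>)) * fps_const (d_part \<alpha> \<mu> l) *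
          (\<Sum>q\<le>m. \<Sum>k\<le>m. fps_const (gsymb \<mu> q k) * T ^ q * Y ^ k))"
    by (subst sum.swap) (simp only: sum_distrib_left)
  also have "\<dots> = (\<Sum>\<mu>\<in>partitions_of m. partition_weight (\<lambda>i. part_series T Y i * fps_const (d_pow \<alpha> i l)) \<mu>)"
  proof (rule sum.cong[OF refl])
    fix \<mu> assume \<mu>: "\<mu> \<in> partitions_of m"
    have "prod_list (map (\<lambda>i. part_series T Y i * fps_const (d_pow \<alpha> i l)) \<mu>)
        = prod_list (map (part_series T Y) \<mu>) * fps_const (d_part \<alpha> \<mu> l)"
      unfolding d_part by (induction \<mu>) (simp_all add: mult_ac)
    then show "fps_const (1 / real (zee \<mu>)) * fps_const (d_part \<alpha> \<mu> l) *
          (\<Sum>q\<le>m. \<Sum>k\<le>m. fps_const (gsymb \<mu> q k) * T ^ q * Y ^ k)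
        = partition_weight (\<lambda>i. part_series T Y i * fps_const (d_pow \<alpha> i l)) \<mu>"
      using gsymb_series[of \<mu> T Y] \<mu> unfolding partition_weight_def
      by (simp add: partitions_of_def mult_ac)
  qed
  finally show ?thesis .
qed

section \<open>One factor for each cell\<close>

text \<open>
  A power series is determined by its logarithmic derivative and its constant term, since the
  differential equation is a recurrence for the coefficients.
\<close>

lemma fps_eqI_log_deriv:
  fixes A B G :: "real fps fps"
  assumes A: "fps_X * fps_deriv A = G * A" and B: "fps_X * fps_deriv B = G * B"
    and G0: "G $ 0 = 0" and AB0: "A $ 0 = B $ 0"
  shows "A = B"
proof -
  have rec: "of_nat n * C $ n = (\<Sum>i=1..n. G $ i * C $ (n - i))"
    if "fps_X * fps_deriv C = G * C" for C n
  proof -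
    have "of_nat n * C $ n = (fps_X * fps_deriv C) $ n"
      by (cases n) (simp_all add: algebra_simps)
    also have "\<dots> = (\<Sum>i=0..n. G $ i * C $ (n - i))"
      by (simp add: that fps_mult_nth)
    also have "\<dots> = (\<Sum>i=1..n. G $ i * C $ (n - i))"
      by (rule sum.mono_neutral_right) (auto simp: G0 Suc_le_eq)
    finally show ?thesis .
  qed
  have "A $ n = B $ n" for n
  proof (induction n rule: less_induct)
    case (less n)
    show ?case
    proof (cases "n = 0")
      case False
      have "of_nat n * A $ n = of_nat n * B $ n"
        unfolding rec[OF A] rec[OF B] using less by (intro sum.cong refl) auto
      then show ?thesis using False by simp
    qed (use AB0 in simp)
  qed
  then show ?thesis by (simp add: fps_eq_iff)
qed

text \<open>
  The series \<open>1 / (1 - Y V)\<close> with \<open>V = vec_series T\<close>, written as a composition because the coefficient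
  ring is not a field.
\<close>

definition cell_series :: "real fps \<Rightarrow> real fps \<Rightarrow> real fps fps" where
  "cell_series T Y = Abs_fps (\<lambda>k. Y ^ k) oo vec_series T"

lemma cell_series_times:
  "cell_series T Y * (1 - fps_const Y * vec_series T) = 1"
proof -
  have "Abs_fps (\<lambda>k. Y ^ k) * (1 - fps_const Y * fps_X) = 1"
    using inv_power_series_1[of Y] by (simp add: inv_power_series_def)
  then have "(Abs_fps (\<lambda>k. Y ^ k) * (1 - fps_const Y * fps_X)) oo vec_series T = 1"
    by simp
  then show ?thesis
    by (simp add: cell_series_def fps_compose_mult_distrib fps_compose_sub_distrib)
qed

text \<open>
  The series in brackets is \<open>- ln (1 - Y V)\<close>; multiplication of the coefficients by \<open>n\<close> is \<open>x d/dx\<close>.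
\<close>

lemma part_series_eq:
  "part_series T Y n = of_nat n * (Abs_fps (\<lambda>k. fps_const (if k = 0 then 0 else 1 / real k) * Y ^ k) oo vec_series T) $ n"
proof (cases "n = 0")
  case False
  have "part_series T Y n = (\<Sum>k=1..n. \<Sum>p\<le>n. fps_const (gbinom n p k) * T ^ p * Y ^ k)"
    unfolding part_series_def by (rule sum.swap)
  also have "\<dots> = (\<Sum>k=1..n. of_nat n * (fps_const (1 / real k) * Y ^ k * (vec_series T ^ k) $ n))"
  proof (rule sum.cong[OF refl])
    fix k assume "k \<in> {1..n}"
    have "fps_const (gbinom n p k) = of_nat n * fps_const (1 / real k) * of_nat (vec_compositions n p k)"
      if "p \<le> n" for p
      using False that by (simp add: gbinom_eq flip: fps_of_nat)
    then show "(\<Sum>p\<le>n. fps_const (gbinom n p k) * T ^ p * Y ^ k)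
        = of_nat n * (fps_const (1 / real k) * Y ^ k * (vec_series T ^ k) $ n)"
      unfolding vec_series_power_nth sum_distrib_left
      by (intro sum.cong refl) (simp only: atMost_iff mult_ac)
  qed
  also have "\<dots> = (\<Sum>k=0..n. of_nat n * (fps_const (if k = 0 then 0 else 1 / real k) * Y ^ k * (vec_series T ^ k) $ n))"
    by (rule sum.mono_neutral_cong_left) auto
  finally show ?thesis by (simp add: fps_compose_nth sum_distrib_left)
qed (simp add: part_series_def)

text \<open>
  The one-part symbols are the coefficients of the logarithmic derivative of \<open>1 / (1 - Y V)\<close>.
\<close>

lemma cell_series_log_deriv:
  "fps_X * fps_deriv (cell_series T Y) = Abs_fps (part_series T Y) * cell_series T Y"
proof -
  let ?P = "cell_series T Y" and ?X = "vec_series T"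
  define L where "L = Abs_fps (\<lambda>k. fps_const (if k = 0 then 0 else 1 / real k) * Y ^ k)"
  have dL: "fps_deriv L = fps_const Y * Abs_fps (\<lambda>k. Y ^ k)"
  proof (rule fps_ext)
    fix n
    have "fps_const (real (Suc n)) * fps_const (1 / real (Suc n)) = 1"
      by (simp only: fps_const_mult) simp
    then have "of_nat (Suc n) * fps_const (1 / real (Suc n)) = 1"
      by (simp only: fps_of_nat)
    then show "fps_deriv L $ n = (fps_const Y * Abs_fps (\<lambda>k. Y ^ k)) $ n"
      by (simp add: L_def mult.assoc[symmetric] del: of_nat_Suc)
  qed
  have part: "Abs_fps (part_series T Y) = fps_X * (fps_const Y * ?P * fps_deriv ?X)"
  proof -
    have "Abs_fps (part_series T Y) = fps_X * fps_deriv (L oo ?X)"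
    proof (rule fps_ext)
      fix n
      show "Abs_fps (part_series T Y) $ n = (fps_X * fps_deriv (L oo ?X)) $ n"
        by (cases n) (simp_all add: part_series_eq L_def del: of_nat_Suc)
    qed
    also have "fps_deriv (L oo ?X) = fps_const Y * ?P * fps_deriv ?X"
      by (simp add: fps_compose_deriv dL fps_compose_mult_distrib cell_series_def)
    finally show ?thesis .
  qed
  have "fps_deriv (?P * (1 - fps_const Y * ?X)) = 0"
    by (simp only: cell_series_times) simp
  then have "fps_deriv ?P * (1 - fps_const Y * ?X) = ?P * (fps_const Y * fps_deriv ?X)"
    by (simp add: algebra_simps)
  then have "fps_deriv ?P * (1 - fps_const Y * ?X) * ?P = ?P * (fps_const Y * fps_deriv ?X) * ?P"
    by simp
  moreover have "fps_deriv ?P * (1 - fps_const Y * ?X) * ?P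
      = fps_deriv ?P * (?P * (1 - fps_const Y * ?X))"
    by (simp only: mult_ac)
  ultimately have "fps_deriv ?P = ?P * (fps_const Y * fps_deriv ?X) * ?P"
    by (simp add: cell_series_times)
  then show ?thesis unfolding part by (simp add: mult_ac)
qed

text \<open>
  Both sides have the same logarithmic derivative: on the left by the exponential formula, on the
  right because a power sum adds up the scaled logarithmic derivatives of the factors.
\<close>

lemma partition_series_eq_prod:
  fixes c :: "'c \<Rightarrow> real"
  assumes "finite C"
  shows "Abs_fps (\<lambda>m. \<Sum>\<mu>\<in>partitions_of m. partition_weight (\<lambda>i. part_series T Y i * fps_const (\<Sum>x\<in>C. c x ^ i)) \<mu>)
       = (\<Prod>x\<in>C. cell_series T Y oo (fps_const (fps_const (c x)) * fps_X))"
    (is "?H = ?P")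
proof -
  define G where "G = Abs_fps (\<lambda>i. part_series T Y i * fps_const (\<Sum>x\<in>C. c x ^ i))"
  define D where "D x = fps_const (fps_const (c x)) * (fps_X :: real fps fps)" for x
  have G0: "G $ 0 = 0" by (simp add: G_def part_series_def)
  show ?thesis
  proof (rule fps_eqI_log_deriv[OF _ _ G0])
    show "fps_X * fps_deriv ?H = G * ?H"
    proof (rule fps_ext)
      fix n
      have "(fps_X * fps_deriv ?H) $ n = of_nat n * ?H $ n"
        by (cases n) (simp_all add: algebra_simps)
      also have "\<dots> = (\<Sum>i=1..n. G $ i * ?H $ (n - i))"
        by (simp only: fps_nth_Abs_fps partition_weight_recurrence G_def)
      also have "\<dots> = (\<Sum>i=0..n. G $ i * ?H $ (n - i))"
        by (rule sum.mono_neutral_left) (auto simp: G0 Suc_le_eq)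
      finally show "(fps_X * fps_deriv ?H) $ n = (G * ?H) $ n"
        by (simp only: fps_mult_nth)
    qed
    have cell: "fps_X * fps_deriv (cell_series T Y oo D x)
        = Abs_fps (\<lambda>i. part_series T Y i * fps_const (c x ^ i)) * (cell_series T Y oo D x)" for x
    proof -
      have D0: "D x $ 0 = 0" by (simp add: D_def)
      have "fps_X * fps_deriv (cell_series T Y oo D x)
          = D x * (fps_deriv (cell_series T Y) oo D x)"
        by (simp add: fps_compose_deriv[OF D0]) (simp add: D_def mult_ac)
      also have "\<dots> = (fps_X * fps_deriv (cell_series T Y)) oo D x"
        by (simp add: fps_compose_mult_distrib[OF D0] D0)
      also have "\<dots> = (Abs_fps (part_series T Y) oo D x) * (cell_series T Y oo D x)"
        by (simp add: cell_series_log_deriv fps_compose_mult_distrib[OF D0])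
      also have "Abs_fps (part_series T Y) oo D x = Abs_fps (\<lambda>i. part_series T Y i * fps_const (c x ^ i))"
        unfolding D_def fps_compose_linear by (simp add: mult.commute fps_const_power)
      finally show ?thesis .
    qed
    have "fps_X * fps_deriv (\<Prod>x\<in>C. cell_series T Y oo D x)
        = Abs_fps (\<lambda>i. part_series T Y i * fps_const (\<Sum>x\<in>C. c x ^ i)) * (\<Prod>x\<in>C. cell_series T Y oo D x)"
      using assms
    proof (induction C rule: finite_induct)
      case empty
      then show ?case by (simp add: fps_eq_iff fps_mult_nth)
    next
      case (insert a C)
      have "Abs_fps (\<lambda>i. part_series T Y i * fps_const (\<Sum>x\<in>insert a C. c x ^ i))
          = Abs_fps (\<lambda>i. part_series T Y i * fps_const (c a ^ i))
            + Abs_fps (\<lambda>i. part_series T Y i * fps_const (\<Sum>x\<in>C. c x ^ i))"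
        using insert by (simp add: fps_eq_iff algebra_simps flip: fps_const_add)
      moreover have "fps_X * fps_deriv (\<Prod>x\<in>insert a C. cell_series T Y oo D x)
          = (fps_X * fps_deriv (cell_series T Y oo D a)) * (\<Prod>x\<in>C. cell_series T Y oo D x)
            + (cell_series T Y oo D a) * (fps_X * fps_deriv (\<Prod>x\<in>C. cell_series T Y oo D x))"
        using insert.hyps by (simp add: algebra_simps)
      ultimately show ?case
        using insert.hyps by (simp only: cell insert.IH prod.insert) (simp add: algebra_simps)
    qed
    then show "fps_X * fps_deriv ?P = G * ?P" by (simp only: G_def D_def)
    have "?H $ 0 = 1"
      by (simp add: partitions_of_0 partition_weight_def zee_def)
    moreover have "(\<Prod>x\<in>C. A x) $ 0 = (\<Prod>x\<in>C. A x $ 0)" for A :: "'c \<Rightarrow> real fps fps"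
      by (induction C rule: infinite_finite_induct) simp_all
    then have "?P $ 0 = 1" by (simp add: cell_series_def)
    ultimately show "?H $ 0 = ?P $ 0" by simp
  qed
qed

section \<open>Substitution of the inner variable for the outer one\<close>

text \<open>
  The substitution \<open>x = u\<close>, that is \<open>\<Sum>\<^sub>i A\<^sub>i x^i \<mapsto> \<Sum>\<^sub>i A\<^sub>i u^i\<close>. It converges formally for every series \<open>A\<close> and is a
  ring homomorphism.
\<close>

definition eval_at_X :: "'a::comm_ring_1 fps fps \<Rightarrow> 'a fps" where
  "eval_at_X A = Abs_fps (\<lambda>r. \<Sum>i\<le>r. A $ i $ (r - i))"

lemma eval_at_X_nth: "eval_at_X A $ r = (\<Sum>i\<le>r. A $ i $ (r - i))"
  by (simp add: eval_at_X_def)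

lemma eval_at_X_mult: "eval_at_X (A * B) = eval_at_X A * eval_at_X B"
proof (rule fps_ext)
  fix r :: nat
  \<comment> \<open>The splittings of \<open>r\<close> into the degrees in \<open>x\<close> and in \<open>u\<close> of a term of \<open>A\<close> and of a term of \<open>B\<close>.\<close>
  define Q where "Q = {(a, b, c, d). a + b + c + d = r}"
  define \<phi> where "\<phi> = (\<lambda>(a, b, c, d). A $ a $ b * B $ c $ d)"
  have "eval_at_X (A * B) $ r = (\<Sum>i\<le>r. \<Sum>a\<le>i. \<Sum>b\<le>r - i. A $ a $ b * B $ (i - a) $ (r - i - b))"
    by (simp add: eval_at_X_nth fps_mult_nth fps_sum_nth atMost_atLeast0)
  also have "\<dots> = (\<Sum>(i, a, b)\<in>(SIGMA i:{..r}. {..i} \<times> {..r - i}). A $ a $ b * B $ (i - a) $ (r - i - b))"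
    by (simp add: sum.Sigma sum.cartesian_product)
  also have "\<dots> = sum \<phi> Q"
    by (rule sum.reindex_bij_witness[where i = "\<lambda>(a, b, c, d). (a + c, a, b)"
          and j = "\<lambda>(i, a, b). (a, b, i - a, r - i - b)"]) (clarsimp simp: Q_def \<phi>_def)+
  also have "\<dots> = (\<Sum>(s, a, c)\<in>(SIGMA s:{..r}. {..s} \<times> {..r - s}). A $ a $ (s - a) * B $ c $ (r - s - c))"
    by (rule sum.reindex_bij_witness[where j = "\<lambda>(a, b, c, d). (a + b, a, c)"
          and i = "\<lambda>(s, a, c). (a, s - a, c, r - s - c)"]) (clarsimp simp: Q_def \<phi>_def)+
  also have "\<dots> = (\<Sum>s\<le>r. \<Sum>a\<le>s. \<Sum>c\<le>r - s. A $ a $ (s - a) * B $ c $ (r - s - c))"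
    by (simp add: sum.Sigma sum.cartesian_product)
  also have "\<dots> = (eval_at_X A * eval_at_X B) $ r"
    by (simp add: eval_at_X_nth fps_mult_nth sum_product atMost_atLeast0)
  finally show "eval_at_X (A * B) $ r = (eval_at_X A * eval_at_X B) $ r" .
qed

lemma eval_at_X_diff: "eval_at_X (A - B) = eval_at_X A - eval_at_X B"
  by (simp add: fps_eq_iff eval_at_X_nth sum_subtractf)

lemma eval_at_X_const [simp]: "eval_at_X (fps_const a) = a"
  by (rule fps_ext) (auto simp: eval_at_X_nth if_distrib if_distribR cong: if_cong)

lemma eval_at_X_1 [simp]: "eval_at_X 1 = 1"
  using eval_at_X_const[of 1] by (simp del: eval_at_X_const)

lemma eval_at_X_X [simp]: "eval_at_X fps_X = fps_X"
proof (rule fps_ext)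
  fix r
  have "eval_at_X fps_X $ r = (\<Sum>i\<le>r. if i = 1 then (if r = 1 then 1 else 0) else (0 :: 'a))"
    unfolding eval_at_X_nth by (intro sum.cong refl) (auto simp: fps_X_def)
  then show "eval_at_X fps_X $ r = (fps_X :: 'a fps) $ r"
    by (auto simp: fps_X_def)
qed

lemma eval_at_X_prod: "eval_at_X (\<Prod>x\<in>C. f x) = (\<Prod>x\<in>C. eval_at_X (f x))"
  by (induction C rule: infinite_finite_induct) (simp_all add: eval_at_X_mult)

section \<open>The Pieri side\<close>

lemma lagrange_interpolation:
  fixes x :: "'i \<Rightarrow> real"
  assumes I: "finite I" "inj_on x I" and Q: "degree Q < card I"
  shows "(\<Sum>i\<in>I. smult (poly Q (x i) / (\<Prod>j\<in>I - {i}. x i - x j)) (\<Prod>j\<in>I - {i}. [:- x j, 1:])) = Q"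
    (is "?L = Q")
proof (rule poly_eqI_degree[where A = "x ` I"])
  have "degree (smult c (\<Prod>j\<in>I - {i}. [:- x j, 1:])) \<le> card I - 1" if "i \<in> I" for i c
  proof -
    have "degree (\<Prod>j\<in>I - {i}. [:- x j, 1:]) \<le> (\<Sum>j\<in>I - {i}. degree [:- x j, 1:])"
      using degree_prod_sum_le[of "I - {i}" "\<lambda>j. [:- x j, 1:]"] I by (simp add: o_def)
    also have "\<dots> = card I - 1" using that I by (simp add: card_Diff_singleton)
    finally show ?thesis using degree_smult_le order_trans by blast
  qed
  then have "degree ?L \<le> card I - 1" by (intro degree_sum_le I(1))
  then show "card (x ` I) > degree ?L" "card (x ` I) > degree Q"
    using Q I by (auto simp: card_image)
next
  fix z assume "z \<in> x ` I"
  then obtain k where k: "k \<in> I" "z = x k" by auto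
  have ne: "(\<Prod>j\<in>I - {k}. x k - x j) \<noteq> 0"
    using I k by (auto simp: inj_on_def)
  have "poly ?L z = (\<Sum>i\<in>I. poly Q (x i) / (\<Prod>j\<in>I - {i}. x i - x j) * (\<Prod>j\<in>I - {i}. z - x j))"
    by (simp add: poly_sum poly_prod)
  also have "\<dots> = (\<Sum>i\<in>{k}. poly Q (x i) / (\<Prod>j\<in>I - {i}. x i - x j) * (\<Prod>j\<in>I - {i}. z - x j))"
  proof (rule sum.mono_neutral_right)
    show "\<forall>i\<in>I - {k}. poly Q (x i) / (\<Prod>j\<in>I - {i}. x i - x j) * (\<Prod>j\<in>I - {i}. z - x j) = 0"
    proof
      fix i assume "i \<in> I - {k}"
      then have "(\<Prod>j\<in>I - {i}. z - x j) = 0"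
        using I k by (intro prod_zero) auto
      then show "poly Q (x i) / (\<Prod>j\<in>I - {i}. x i - x j) * (\<Prod>j\<in>I - {i}. z - x j) = 0" by simp
    qed
  qed (use I k in auto)
  also have "\<dots> = poly Q z" using ne k by simp
  finally show "poly ?L z = poly Q z" .
qed

definition linear_factor :: "real \<Rightarrow> real fps" where
  "linear_factor t = 1 - fps_const t * fps_X"

lemma linear_factor_nonzero: "linear_factor t \<noteq> 0"
proof
  assume "linear_factor t = 0"
  then have "linear_factor t $ 0 = 0" by simp
  then show False by (simp add: linear_factor_def)
qed

lemma linear_factor_prod_nonzero: "finite A \<Longrightarrow> (\<Prod>x\<in>A. linear_factor (t x)) \<noteq> 0"
  by (simp add: linear_factor_nonzero)

text \<open>
  Lagrange interpolation of \<open>\<Prod>\<^sub>j (z - y\<^sub>j)\<close> at the nodes \<open>x\<^sub>i\<close>, read at \<open>z = 1 / u\<close>. One of the nodes may be 0,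
  so the reversed identity cannot be obtained by interpolation at the points \<open>1 / x\<^sub>i\<close>; instead it
  holds at every \<open>u \<noteq> 0\<close> and hence as an identity of polynomials.
\<close>

lemma partial_fractions:
  fixes x :: "nat \<Rightarrow> real" and y :: "nat \<Rightarrow> real"
  assumes inj: "inj_on x {1..n + 1}"
  shows "(\<Sum>i\<in>{1..n + 1}. fps_const ((\<Prod>j\<in>{1..n}. x i - y j) / (\<Prod>j\<in>{1..n + 1} - {i}. x i - x j))
            * (\<Prod>j\<in>{1..n + 1} - {i}. linear_factor (x j)))
       = (\<Prod>j\<in>{1..n}. linear_factor (y j))"
proof -
  define c where "c i = (\<Prod>j\<in>{1..n}. x i - y j) / (\<Prod>j\<in>{1..n + 1} - {i}. x i - x j)" for i
  define Q where "Q = (\<Prod>j\<in>{1..n}. [:- y j, 1:])"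
  define L where "L = (\<Sum>i\<in>{1..n + 1}. smult (c i) (\<Prod>j\<in>{1..n + 1} - {i}. [:1, - x j:]))"
  define R where "R = (\<Prod>j\<in>{1..n}. [:1, - y j:])"
  have "degree Q \<le> (\<Sum>j\<in>{1..n}. degree [:- y j, 1:])"
    using degree_prod_sum_le[of "{1..n}" "\<lambda>j. [:- y j, 1:]"] by (simp add: Q_def o_def)
  then have "degree Q < card {1..n + 1}" by simp
  from lagrange_interpolation[OF _ inj this]
  have lag: "(\<Sum>i\<in>{1..n + 1}. smult (c i) (\<Prod>j\<in>{1..n + 1} - {i}. [:- x j, 1:])) = Q"
    by (simp add: c_def Q_def poly_prod)
  have eq: "poly L u = poly R u" if u: "u \<noteq> 0" for u
  proof -
    have scale: "(\<Prod>j\<in>A. 1 - t j * u) = u ^ card A * (\<Prod>j\<in>A. 1 / u - t j)" for A and t :: "nat \<Rightarrow> real"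
      using u by (subst prod_constant[symmetric], subst prod.distrib[symmetric], intro prod.cong refl)
        (simp add: field_simps)
    have "poly L u = (\<Sum>i\<in>{1..n + 1}. c i * (\<Prod>j\<in>{1..n + 1} - {i}. 1 - x j * u))"
      by (simp add: L_def poly_sum poly_prod mult.commute)
    also have "\<dots> = (\<Sum>i\<in>{1..n + 1}. u ^ n * (c i * (\<Prod>j\<in>{1..n + 1} - {i}. 1 / u - x j)))"
      by (intro sum.cong refl) (simp add: scale)
    also have "\<dots> = u ^ n * poly Q (1 / u)"
    proof -
      have "poly [:- t, 1:] v = v - t" for t v :: real by simp
      then show ?thesis
        unfolding lag[symmetric] by (simp only: poly_sum poly_smult poly_prod sum_distrib_left)
    qed
    also have "\<dots> = (\<Prod>j\<in>{1..n}. 1 - y j * u)"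
      by (simp add: scale Q_def poly_prod)
    also have "\<dots> = poly R u"
      by (simp add: R_def poly_prod mult.commute)
    finally show ?thesis .
  qed
  have "L = R"
  proof (rule ccontr)
    assume "L \<noteq> R"
    then have "finite {u. poly (L - R) u = 0}" by (intro poly_roots_finite) simp
    moreover have "- {0} \<subseteq> {u. poly (L - R) u = 0}" using eq by auto
    moreover have "infinite (- {0 :: real})"
      by (simp add: infinite_UNIV_char_0 Compl_eq_Diff_UNIV)
    ultimately show False using finite_subset by blast
  qed
  then have "fps_of_poly L = fps_of_poly R" by simp
  moreover have "fps_of_poly [:1, - t:] = linear_factor t" for t
    by (simp add: fps_of_poly_linear' linear_factor_def flip: fps_const_neg)
  ultimately show ?thesis
    by (simp only: L_def R_def c_def fps_of_poly_sum fps_of_poly_smult fps_of_poly_prod)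
qed

definition corner_content :: "real \<Rightarrow> nat list \<Rightarrow> nat \<Rightarrow> real" where
  "corner_content \<alpha> l i = real (part l i) - (real i - 1) / \<alpha>"

lemma part_antimono:
  assumes "is_partition l" "1 \<le> i" "i \<le> j"
  shows "part l j \<le> part l i"
proof (cases "j \<le> length l")
  case True
  then show ?thesis
    using assms sorted_wrt_nth_less[of "(\<ge>)" l "i - 1" "j - 1"]
    by (cases "i = j") (auto simp: Defs.part_def is_partition_def)
qed (simp add: Defs.part_def)

lemma corner_content_less:
  assumes "0 < \<alpha>" "is_partition l" "1 \<le> i" "i < j"
  shows "corner_content \<alpha> l j < corner_content \<alpha> l i"
proof -
  have "(real i - 1) / \<alpha> < (real j - 1) / \<alpha>"
    using assms by (intro divide_strict_right_mono) auto
  then show ?thesis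
    using part_antimono[of l i j] assms by (simp add: corner_content_def)
qed

lemma inj_corner_content:
  assumes "0 < \<alpha>" "is_partition l"
  shows "inj_on (corner_content \<alpha> l) {1..length l + 1}"
proof (rule linorder_inj_onI)
  fix i j assume "i < j" "i \<in> {1..length l + 1}"
  then show "corner_content \<alpha> l i \<noteq> corner_content \<alpha> l j"
    using corner_content_less[OF assms, of i j] by auto
qed auto

text \<open>
  The Pieri coefficients are the interpolation weights. Since the part
  with index \<open>n + 1\<close> is 0, the numerator factor of that index is \<open>1 / \<alpha>\<close> times the denominator in
  front of the product and cancels it; this leaves a numerator over the \<open>n\<close> rows only.
\<close>

lemma pieri_eq:
  assumes \<alpha>: "0 < \<alpha>" and i: "i \<in> {1..length l + 1}"
  shows "pieri \<alpha> l i = (\<Prod>j\<in>{1..length l}. corner_content \<alpha> l i - (corner_content \<alpha> l j - 1 / \<alpha>))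
     / (\<Prod>j\<in>{1..length l + 1} - {i}. corner_content \<alpha> l i - corner_content \<alpha> l j)"
proof -
  let ?n = "length l" and ?x = "corner_content \<alpha> l"
  define E where "E = \<alpha> * real (part l i) + real ?n - real i + 2"
  have E: "0 < E"
  proof -
    have "0 \<le> \<alpha> * real (part l i)" using \<alpha> by simp
    moreover have "real i \<le> real ?n + 1" using i by simp
    ultimately show ?thesis by (simp add: E_def)
  qed
  have last: "?x i - (?x (?n + 1) - 1 / \<alpha>) = E / \<alpha>"
    using \<alpha> by (simp add: corner_content_def E_def Defs.part_def field_simps)
  have "(\<Prod>j\<in>{1..?n + 1} - {i}. ?x i - (?x j - 1 / \<alpha>)) * (1 / \<alpha>)
      = (\<Prod>j\<in>{1..?n + 1}. ?x i - (?x j - 1 / \<alpha>))"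
    using i by (subst (2) prod.remove[of _ i]) auto
  also have "\<dots> = (\<Prod>j\<in>{1..?n}. ?x i - (?x j - 1 / \<alpha>)) * (E / \<alpha>)"
    using last by simp
  finally have num: "(\<Prod>j\<in>{1..?n + 1} - {i}. ?x i - (?x j - 1 / \<alpha>))
      = (\<Prod>j\<in>{1..?n}. ?x i - (?x j - 1 / \<alpha>)) * E"
    using \<alpha> by (simp add: field_simps)
  have "pieri \<alpha> l i = 1 / E * (\<Prod>j\<in>{1..?n + 1} - {i}. (?x i - (?x j - 1 / \<alpha>)) / (?x i - ?x j))"
    unfolding pieri_def E_def
  proof (intro arg_cong2[of _ _ _ _ "(*)"] prod.cong refl)
    fix j
    let ?D = "\<alpha> * (real (part l i) - real (part l j)) + real j - real i"
    have "?x i - (?x j - 1 / \<alpha>) = (?D + 1) / \<alpha>" "?x i - ?x j = ?D / \<alpha>"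
      using \<alpha> by (simp_all add: corner_content_def field_simps)
    then show "(?D + 1) / ?D = (?x i - (?x j - 1 / \<alpha>)) / (?x i - ?x j)"
      using \<alpha> by simp
  qed
  also have "\<dots> = (\<Prod>j\<in>{1..?n}. ?x i - (?x j - 1 / \<alpha>)) / (\<Prod>j\<in>{1..?n + 1} - {i}. ?x i - ?x j)"
    unfolding prod_dividef num using E by simp
  finally show ?thesis .
qed

lemma s_sum_series_rows:
  assumes "0 < \<alpha>" "is_partition l"
  shows "Abs_fps (\<lambda>r. s_sum \<alpha> r l) * (\<Prod>j\<in>{1..length l + 1}. linear_factor (corner_content \<alpha> l j))
       = (\<Prod>j\<in>{1..length l}. linear_factor (corner_content \<alpha> l j - 1 / \<alpha>))"
proof -
  let ?n = "length l" and ?x = "corner_content \<alpha> l"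
  have geo: "inv_power_series 1 t * linear_factor t = 1" for t
    unfolding linear_factor_def by (rule inv_power_series_1)
  have "Abs_fps (\<lambda>r. s_sum \<alpha> r l) = (\<Sum>i\<in>{1..?n + 1}. fps_const (pieri \<alpha> l i) * inv_power_series 1 (?x i))"
    by (rule fps_ext)
       (simp add: s_sum_def fps_sum_nth inv_power_series_def corner_content_def mult.commute)
  then have "Abs_fps (\<lambda>r. s_sum \<alpha> r l) * (\<Prod>j\<in>{1..?n + 1}. linear_factor (?x j))
      = (\<Sum>i\<in>{1..?n + 1}. fps_const (pieri \<alpha> l i) * inv_power_series 1 (?x i) * (\<Prod>j\<in>{1..?n + 1}. linear_factor (?x j)))"
    by (simp only: sum_distrib_right)
  also have "\<dots> = (\<Sum>i\<in>{1..?n + 1}. fps_const (pieri \<alpha> l i) * (\<Prod>j\<in>{1..?n + 1} - {i}. linear_factor (?x j)))"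
  proof (rule sum.cong[OF refl])
    fix i assume i: "i \<in> {1..?n + 1}"
    have "fps_const (pieri \<alpha> l i) * inv_power_series 1 (?x i) * (\<Prod>j\<in>{1..?n + 1}. linear_factor (?x j))
        = fps_const (pieri \<alpha> l i) * (inv_power_series 1 (?x i) * linear_factor (?x i))
          * (\<Prod>j\<in>{1..?n + 1} - {i}. linear_factor (?x j))"
      by (subst prod.remove[OF _ i]) (simp_all only: finite_atLeastAtMost mult.assoc)
    then show "fps_const (pieri \<alpha> l i) * inv_power_series 1 (?x i) * (\<Prod>j\<in>{1..?n + 1}. linear_factor (?x j))
        = fps_const (pieri \<alpha> l i) * (\<Prod>j\<in>{1..?n + 1} - {i}. linear_factor (?x j))"
      by (simp only: geo mult_1_right)
  qed
  also have "\<dots> = (\<Prod>j\<in>{1..?n}. linear_factor (?x j - 1 / \<alpha>))"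
    using partial_fractions[OF inj_corner_content[OF assms], of "\<lambda>j. ?x j - 1 / \<alpha>"]
    by (simp only: pieri_eq[OF assms(1)] cong: sum.cong)
  finally show ?thesis .
qed

lemma diagram_eq: "diagram l = (SIGMA i:{1..length l}. {1..part l i})"
  by (auto simp: diagram_def)

lemma finite_diagram: "finite (diagram l)"
  by (simp add: diagram_eq)

lemma card_diagram: "card (diagram l) = sum_list l"
proof -
  have "card (diagram l) = (\<Sum>i\<in>{1..length l}. l ! (i - 1))"
    unfolding diagram_eq by (simp add: card_SigmaI) (intro sum.cong refl, simp add: Defs.part_def)
  also have "\<dots> = (\<Sum>i<length l. l ! i)"
    by (rule sum.reindex_bij_witness[where i = Suc and j = "\<lambda>i. i - 1"]) auto
  finally show ?thesis by (simp add: sum_list_sum_nth atLeast0LessThan)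
qed

text \<open>
  The contents \<open>a, a + 1, \<dots>, a + m - 1\<close> of one row. Both shifts of a product by one step leave only its
  end factors.
\<close>

lemma row_telescope:
  "(\<Prod>j=1..m. linear_factor (a + real j - 1) * linear_factor (a + real j - b))
      * (linear_factor (a + real m) * linear_factor (a - b))
   = (\<Prod>j=1..m. linear_factor (a + real j) * linear_factor (a + real j - 1 - b))
      * (linear_factor a * linear_factor (a + real m - b))"
proof (induction m)
  case (Suc m)
  let ?A = "\<lambda>j. linear_factor (a + real j - 1) * linear_factor (a + real j - b)"
  let ?B = "\<lambda>j. linear_factor (a + real j) * linear_factor (a + real j - 1 - b)"
  have "prod ?A {1..Suc m} * (linear_factor (a + real (Suc m)) * linear_factor (a - b))
      = (prod ?A {1..m} * (linear_factor (a + real m) * linear_factor (a - b)))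
        * (linear_factor (a + real (Suc m) - b) * linear_factor (a + real (Suc m)))"
    by (simp add: mult_ac)
  also have "\<dots> = prod ?B {1..m} * (linear_factor a * linear_factor (a + real m - b))
        * (linear_factor (a + real (Suc m) - b) * linear_factor (a + real (Suc m)))"
    by (simp only: Suc)
  also have "\<dots> = prod ?B {1..Suc m} * (linear_factor a * linear_factor (a + real (Suc m) - b))"
    by (simp add: mult_ac)
  finally show ?case .
qed (simp add: mult.commute)

text \<open>
  The product over rows turned into a product over cells. The end factors at the beginning of the rows,
  with \<open>a i = - (i - 1) / \<alpha>\<close>, telescope once more in the vertical direction.
\<close>

lemma s_sum_series:
  assumes "0 < \<alpha>" "is_partition l"
  shows "Abs_fps (\<lambda>r. s_sum \<alpha> r l)
        * (\<Prod>(i, j)\<in>diagram l. linear_factor (cell_content \<alpha> i j + 1) * linear_factor (cell_content \<alpha> i j - 1 / \<alpha>))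
      = (\<Prod>(i, j)\<in>diagram l. linear_factor (cell_content \<alpha> i j) * linear_factor (cell_content \<alpha> i j + (1 - 1 / \<alpha>)))"
    (is "?S * ?Den = ?Num")
proof -
  let ?n = "length l" and ?x = "corner_content \<alpha> l"
  define a where "a i = - ((real i - 1) / \<alpha>)" for i :: nat
  have a_Suc: "a i - 1 / \<alpha> = a (Suc i)" for i
    by (simp add: a_def diff_divide_distrib add_divide_distrib)
  define K where "K = (\<Prod>i=1..?n. linear_factor (a i))"
  have K0: "K \<noteq> 0" unfolding K_def by (rule linear_factor_prod_nonzero) simp
  have "(\<Prod>i=1..n. linear_factor (a (Suc i))) = (\<Prod>i=1..n. linear_factor (a i)) * linear_factor (a (Suc n))" for n
    by (induction n) (simp_all add: a_def linear_factor_def)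
  \<comment> \<open>The factor with \<open>i = 1\<close> is 1, and \<open>a (n + 1)\<close> is the content \<open>x\<close> of the row below the diagram.\<close>
  then have shift: "(\<Prod>i=1..?n. linear_factor (a (Suc i))) = K * linear_factor (?x (?n + 1))"
    by (simp add: K_def a_def corner_content_def Defs.part_def)
  have Num: "?Num = (\<Prod>i=1..?n. \<Prod>j=1..part l i. linear_factor (a i + real j - 1) * linear_factor (a i + real j - 1 / \<alpha>))"
    unfolding diagram_eq by (subst prod.Sigma[symmetric]) (auto simp: cell_content_def a_def algebra_simps)
  have Den: "?Den = (\<Prod>i=1..?n. \<Prod>j=1..part l i. linear_factor (a i + real j) * linear_factor (a i + real j - 1 - 1 / \<alpha>))"
    unfolding diagram_eq by (subst prod.Sigma[symmetric]) (auto simp: cell_content_def a_def algebra_simps)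
  have x: "?x i = a i + real (part l i)" for i by (simp add: corner_content_def a_def)
  have "?Num * ((\<Prod>i=1..?n. linear_factor (?x i)) * (\<Prod>i=1..?n. linear_factor (a (Suc i))))
      = ?Den * (K * (\<Prod>i=1..?n. linear_factor (?x i - 1 / \<alpha>)))"
    unfolding Num Den K_def x by (simp only: prod.distrib[symmetric] row_telescope a_Suc[symmetric])
  then have "K * (?Num * (\<Prod>i=1..?n + 1. linear_factor (?x i)))
      = K * (?Den * (\<Prod>i=1..?n. linear_factor (?x i - 1 / \<alpha>)))"
    unfolding shift by (simp add: mult_ac)
  then have "?Num * (\<Prod>i=1..?n + 1. linear_factor (?x i)) = ?Den * (\<Prod>i=1..?n. linear_factor (?x i - 1 / \<alpha>))"
    using K0 by simp
  also have "\<dots> = ?S * ?Den * (\<Prod>i=1..?n + 1. linear_factor (?x i))"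
    by (simp only: s_sum_series_rows[OF assms, symmetric] mult_ac)
  finally show ?thesis
    using linear_factor_prod_nonzero[of "{1..?n + 1}" ?x] by (simp del: prod.atLeastAtMost_shift_bounds)
qed

section \<open>Comparison of the two generating functions\<close>

text \<open>
  Here \<open>T = 1 / (1 - w u)\<close> and \<open>I = 1 / (1 - Z)\<close>. With \<open>m = (1 - c u) (1 - c T u)\<close> the cell series at \<open>x = u\<close> is
  \<open>m / (m - Y (1 - m))\<close> for \<open>Y = Z / (1 - Z)\<close>, that is \<open>(1 - Z) m / (m - Z)\<close>. Multiplying numerator and
  denominator by \<open>1 - w u\<close> clears \<open>T\<close>, and the denominator becomes the quadratic polynomial that splits
  into the two linear factors.
\<close>

lemma cell_series_at_X:
  fixes b c :: real
  defines "w \<equiv> 1 - b"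
  assumes T: "T * linear_factor w = 1" and Z: "Z = fps_const b * fps_X ^ 2 * T" and I: "I * (1 - Z) = 1"
  shows "eval_at_X (cell_series T (Z * I) oo (fps_const (fps_const c) * fps_X))
          * (linear_factor (c + 1) * linear_factor (c - b))
       = (1 - Z) * (linear_factor c * linear_factor (c + w))"
proof -
  define Y where "Y = Z * I"
  define P where "P = cell_series T Y"
  define v where "v = vec_series T"
  define M where "M = (1 - fps_X) * (1 - fps_const T * fps_X)"
  define D where "D = fps_const (fps_const c) * (fps_X :: real fps fps)"
  define E where "E = eval_at_X (P oo D)"
  define m where "m = linear_factor c * (1 - T * (fps_const c * fps_X))"
  have D0: "D $ 0 = 0" by (simp add: D_def)
  have vM: "v * M = 1 - M"
    using vec_series_eq[of T] by (simp add: v_def M_def algebra_simps)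
  have "P * (M - fps_const Y * (1 - M)) = P * (1 - fps_const Y * v) * M"
    unfolding vM[symmetric] by (simp add: algebra_simps)
  then have PM: "P * (M - fps_const Y * (1 - M)) = M"
    by (simp add: P_def v_def cell_series_times)
  have MD: "M oo D = (1 - D) * (1 - fps_const T * D)"
    by (simp add: M_def fps_compose_mult_distrib[OF D0] fps_compose_sub_distrib D0)
  have "(P oo D) * ((M oo D) - fps_const Y * (1 - (M oo D))) = (P * (M - fps_const Y * (1 - M))) oo D"
    by (simp add: fps_compose_mult_distrib[OF D0] fps_compose_sub_distrib)
  then have "eval_at_X ((P oo D) * ((M oo D) - fps_const Y * (1 - (M oo D)))) = eval_at_X (M oo D)"
    by (simp only: PM)
  moreover have evM: "eval_at_X (M oo D) = m"
    unfolding MD m_def linear_factor_def by (simp add: D_def eval_at_X_mult eval_at_X_diff)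
  ultimately have Em: "E * (m - Y * (1 - m)) = m"
    by (simp add: eval_at_X_mult eval_at_X_diff E_def)
  have Y: "Y * (1 - Z) = Z" using I by (simp add: Y_def mult.assoc)
  have "(m - Y * (1 - m)) * (1 - Z) = m * (1 - Z) - Y * (1 - Z) * (1 - m)"
    by (simp add: algebra_simps)
  also have "\<dots> = m - Z" unfolding Y by (simp add: algebra_simps)
  finally have mZ: "(m - Y * (1 - m)) * (1 - Z) = m - Z" .
  have mB: "m * linear_factor w = linear_factor c * linear_factor (c + w)"
  proof -
    have "m * linear_factor w = linear_factor c * (linear_factor w - T * linear_factor w * (fps_const c * fps_X))"
      by (simp add: m_def algebra_simps)
    also have "linear_factor w - T * linear_factor w * (fps_const c * fps_X) = linear_factor (c + w)"
      unfolding T by (simp add: linear_factor_def algebra_simps flip: fps_const_add)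
    finally show ?thesis .
  qed
  have ZB: "Z * linear_factor w = fps_const b * fps_X ^ 2"
    using T by (simp add: Z mult.assoc)
  have factor: "linear_factor c * linear_factor (c + w) - fps_const b * fps_X ^ 2
      = linear_factor (c + 1) * linear_factor (c - b)"
  proof -
    have "fps_const (c + w) = fps_const c + 1 - fps_const b" "fps_const (c + 1) = fps_const c + 1"
      "fps_const (c - b) = fps_const c - fps_const b"
      by (simp_all add: w_def flip: fps_const_add fps_const_sub)
    then show ?thesis
      unfolding linear_factor_def by (simp only:) (simp add: algebra_simps power2_eq_square)
  qed
  have "E * (linear_factor (c + 1) * linear_factor (c - b)) = E * ((m - Z) * linear_factor w)"
    unfolding factor[symmetric] by (simp only: left_diff_distrib mB ZB)
  also have "\<dots> = E * (m - Y * (1 - m)) * (1 - Z) * linear_factor w"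
    by (simp only: mZ[symmetric] mult.assoc)
  also have "\<dots> = (1 - Z) * (linear_factor c * linear_factor (c + w))"
    by (simp only: Em mB[symmetric] mult_ac)
  finally show ?thesis unfolding E_def P_def Y_def D_def .
qed

text \<open>
  All binomial coefficients that occur in the two expansions have this form. At \<open>a = p = 0\<close> the upper
  argument is \<open>-1\<close> on the left and the truncated 0 on the right, and both sides are 1.
\<close>

lemma binom_shift: "binom (real a + real p - 1) (int p) = real ((p + a - 1) choose p)"
proof (cases p)
  case (Suc k)
  then have "real a + real p - 1 = real (p + a - 1)" by simp
  then show ?thesis by (simp only: binom_def binomial_gbinomial nat_int) simp
qed (simp add: binom_def)

lemma times_compose_nth:
  fixes a b c :: "'a::idom fps"
  assumes "b $ 0 = 0"
  shows "(c * (a oo b)) $ s = (\<Sum>n\<le>s. a $ n * (c * b ^ n) $ s)"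
proof -
  have ext: "(a oo b) $ i = (\<Sum>n\<le>s. a $ n * (b ^ n) $ i)" if "i \<le> s" for i
    unfolding fps_compose_nth atMost_atLeast0
    by (rule sum.mono_neutral_left) (use that assms in \<open>auto simp: startsby_zero_power_prefix\<close>)
  have "(c * (a oo b)) $ s = (\<Sum>i=0..s. \<Sum>n\<le>s. a $ n * (c $ i * (b ^ n) $ (s - i)))"
    unfolding fps_mult_nth by (intro sum.cong refl) (simp add: ext sum_distrib_left mult_ac)
  also have "\<dots> = (\<Sum>n\<le>s. a $ n * (c * b ^ n) $ s)"
    by (subst sum.swap) (simp add: fps_mult_nth sum_distrib_left)
  finally show ?thesis .
qed

text \<open>
  Coefficient extraction from \<open>\<Sum>\<^sub>r s\<^sub>r u^r = (1 - Z)^{-N} H\<close>, where \<open>N = |\<lambda>|\<close> and \<open>H\<close> is the generating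
  function of the functions \<open>F\<close> at \<open>x = u\<close>.
\<close>

lemma s_sum_eq_F_fun:
  fixes \<alpha> :: real
  assumes \<alpha>: "0 < \<alpha>" and l: "is_partition l"
  shows "s_sum \<alpha> r l =
      (\<Sum>(n, p, q)\<in>{(n, p, q). 2 * n + p + q \<le> r}.
         1 / \<alpha> ^ n * (1 - 1 / \<alpha>) ^ p *
         binom (real n + real p + real q - 1) (int p) *
         (\<Sum>k=0..min n (r - 2 * n - p).
            binom (real (sum_list l) + real n - 1) (int n - int k) *
            F_fun \<alpha> (r - 2 * n - p) q k l))"
proof -
  define b where "b = 1 / \<alpha>"
  define w where "w = 1 - b"
  define N where "N = sum_list l"
  define T where "T = inv_power_series 1 w"
  define Z where "Z = fps_const b * fps_X ^ 2 * T"
  define I where "I = inv_power_series 1 1 oo Z"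
  define Y where "Y = Z * I"
  define S where "S = Abs_fps (\<lambda>r. s_sum \<alpha> r l)"
  define H where "H = Abs_fps (\<lambda>m. \<Sum>q\<le>m. \<Sum>k\<le>m. fps_const (F_fun \<alpha> m q k l) * T ^ q * Y ^ k)"
  define c where "c = (\<lambda>(i, j). cell_content \<alpha> i j)"
  have Z0: "Z $ 0 = 0" by (simp add: Z_def)
  have T: "T * linear_factor w = 1"
    unfolding T_def linear_factor_def by (rule inv_power_series_1)
  have I: "I * (1 - Z) = 1"
  proof -
    have "(inv_power_series 1 (1::real) * (1 - fps_const 1 * fps_X)) oo Z = 1"
      by (simp only: inv_power_series_1 fps_compose_1)
    then show ?thesis
      by (simp add: I_def fps_compose_mult_distrib[OF Z0] fps_compose_sub_distrib Z0)
  qed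
  have I_pow: "I ^ j = inv_power_series j 1 oo Z" for j
    unfolding I_def inv_power_series_power[of j 1] by (rule fps_compose_power[OF Z0])

  define Den where "Den = (\<Prod>x\<in>diagram l. linear_factor (c x + 1) * linear_factor (c x - b))"
  define Num where "Num = (\<Prod>x\<in>diagram l. linear_factor (c x) * linear_factor (c x + w))"
  have H_prod: "H = (\<Prod>x\<in>diagram l. cell_series T Y oo (fps_const (fps_const (c x)) * fps_X))"
  proof -
    have "d_pow \<alpha> i l = (\<Sum>x\<in>diagram l. c x ^ i)" for i
      by (simp add: d_pow_def c_def case_prod_unfold)
    then show ?thesis
      using partition_series_eq_prod[OF finite_diagram, of T Y c l]
      by (simp add: H_def F_fun_series)
  qed
  have "eval_at_X H * Den = (\<Prod>x\<in>diagram l. (1 - Z) * (linear_factor (c x) * linear_factor (c x + w)))"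
    unfolding H_prod Den_def eval_at_X_prod Y_def w_def
    by (simp only: prod.distrib[symmetric] cell_series_at_X[OF T[unfolded w_def] Z_def I])
  also have "\<dots> = (1 - Z) ^ N * Num"
    by (simp add: prod.distrib Num_def N_def card_diagram)
  also have "Num = S * Den"
    using s_sum_series[OF \<alpha> l] by (simp add: Num_def Den_def S_def b_def w_def c_def case_prod_unfold)
  finally have "(eval_at_X H - (1 - Z) ^ N * S) * Den = 0"
    by (simp add: algebra_simps)
  moreover have "Den \<noteq> 0"
    unfolding Den_def by (simp add: prod.distrib linear_factor_nonzero finite_diagram)
  ultimately have "eval_at_X H = (1 - Z) ^ N * S" by simp
  then have "I ^ N * eval_at_X H = (I * (1 - Z)) ^ N * S"
    by (simp add: power_mult_distrib mult.assoc)
  then have S: "S = eval_at_X (fps_const (I ^ N) * H)"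
    by (simp add: I eval_at_X_mult)

  \<comment> \<open>Since \<open>I = 1 / (1 - Z)\<close>, the factor \<open>I^N Y^k\<close> is the series \<open>A = x^k / (1 - x)^(N + k)\<close> at \<open>x = Z\<close>.\<close>
  have coeff: "(I ^ N * (T ^ q * Y ^ k)) $ s
      = (\<Sum>n\<le>s div 2. if k \<le> n then b ^ n * w ^ (s - 2 * n) * binom (real n + real (s - 2 * n) + real q - 1) (int (s - 2 * n))
            * binom (real N + real n - 1) (int n - int k) else 0)" for q k s
  proof -
    define A :: "real fps" where "A = fps_X ^ k * inv_power_series (N + k) 1"
    have "I ^ N * (T ^ q * Y ^ k) = T ^ q * (Z ^ k * I ^ (N + k))"
      by (simp add: Y_def power_mult_distrib power_add mult_ac)
    also have "Z ^ k * I ^ (N + k) = A oo Z"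
      by (simp add: A_def fps_compose_mult_distrib[OF Z0] fps_compose_power[OF Z0, symmetric] I_pow Z0)
    finally have "(I ^ N * (T ^ q * Y ^ k)) $ s = (\<Sum>n\<le>s. A $ n * (T ^ q * Z ^ n) $ s)"
      by (simp only: times_compose_nth[OF Z0])
    also have "\<dots> = (\<Sum>n\<le>s div 2. A $ n * (T ^ q * Z ^ n) $ s)"
    proof (rule sum.mono_neutral_right)
      show "\<forall>n\<in>{..s} - {..s div 2}. A $ n * (T ^ q * Z ^ n) $ s = 0"
      proof
        fix n assume "n \<in> {..s} - {..s div 2}"
        then have "s < 2 * n" by auto
        moreover have "T ^ q * Z ^ n = fps_X ^ (2 * n) * (fps_const (b ^ n) * T ^ (n + q))"
          by (simp add: Z_def power_mult_distrib power_add mult_ac fps_const_power flip: power_mult)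
        ultimately show "A $ n * (T ^ q * Z ^ n) $ s = 0"
          by (simp add: fps_X_power_mult_nth)
      qed
    qed auto
    also have "\<dots> = (\<Sum>n\<le>s div 2. if k \<le> n then b ^ n * w ^ (s - 2 * n) * binom (real n + real (s - 2 * n) + real q - 1) (int (s - 2 * n))
            * binom (real N + real n - 1) (int n - int k) else 0)"
    proof (rule sum.cong[OF refl])
      fix n assume "n \<in> {..s div 2}"
      then have n: "2 * n \<le> s" by auto
      have "T ^ q * Z ^ n = fps_X ^ (2 * n) * (fps_const (b ^ n) * T ^ (n + q))"
        by (simp add: Z_def power_mult_distrib power_add mult_ac fps_const_power flip: power_mult)
      also have "T ^ (n + q) = inv_power_series (n + q) w"
        unfolding T_def by (rule inv_power_series_power[symmetric])
      also have "(fps_X ^ (2 * n) * (fps_const (b ^ n) * inv_power_series (n + q) w)) $ s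
          = b ^ n * (real ((s - 2 * n + (n + q) - 1) choose (s - 2 * n)) * w ^ (s - 2 * n))"
        using n by (simp add: fps_X_power_mult_nth inv_power_series_def)
      also have "real ((s - 2 * n + (n + q) - 1) choose (s - 2 * n))
          = binom (real n + real (s - 2 * n) + real q - 1) (int (s - 2 * n))"
        using binom_shift[of "n + q" "s - 2 * n"] by (simp add: algebra_simps)
      finally have TZ: "(T ^ q * Z ^ n) $ s
          = b ^ n * (binom (real n + real (s - 2 * n) + real q - 1) (int (s - 2 * n)) * w ^ (s - 2 * n))" .
      have A: "A $ n = (if k \<le> n then binom (real N + real n - 1) (int n - int k) else 0)"
      proof (cases "k \<le> n")
        case True
        have "binom (real N + real n - 1) (int n - int k)
            = binom (real (N + k) + real (n - k) - 1) (int (n - k))"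
          using True by (simp add: of_nat_diff)
        also have "\<dots> = real ((n - k + (N + k) - 1) choose (n - k))"
          by (rule binom_shift)
        finally show ?thesis using True
          by (simp add: A_def fps_X_power_mult_nth inv_power_series_def)
      qed (simp add: A_def fps_X_power_mult_nth)
      show "A $ n * (T ^ q * Z ^ n) $ s = (if k \<le> n then b ^ n * w ^ (s - 2 * n)
            * binom (real n + real (s - 2 * n) + real q - 1) (int (s - 2 * n))
            * binom (real N + real n - 1) (int n - int k) else 0)"
        unfolding TZ A by simp
    qed
    finally show ?thesis .
  qed

  define \<Psi> where "\<Psi> n p q m = b ^ n * w ^ p * binom (real n + real p + real q - 1) (int p) *
         (\<Sum>k=0..min n m. binom (real N + real n - 1) (int n - int k) * F_fun \<alpha> m q k l)" for n p q m
  have "s_sum \<alpha> r l = (\<Sum>m\<le>r. (I ^ N * H $ m) $ (r - m))"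
  proof -
    have "s_sum \<alpha> r l = S $ r" by (simp add: S_def)
    then show ?thesis by (simp add: S eval_at_X_nth)
  qed
  also have "\<dots> = (\<Sum>m\<le>r. \<Sum>q\<le>m. \<Sum>n\<le>(r - m) div 2. \<Psi> n (r - m - 2 * n) q m)"
  proof (rule sum.cong[OF refl])
    fix m
    have "(I ^ N * H $ m) $ (r - m)
        = (\<Sum>q\<le>m. \<Sum>k\<le>m. (fps_const (F_fun \<alpha> m q k l) * (I ^ N * (T ^ q * Y ^ k))) $ (r - m))"
      by (simp add: H_def sum_distrib_left fps_sum_nth mult_ac)
    also have "\<dots> = (\<Sum>q\<le>m. \<Sum>k\<le>m. \<Sum>n\<le>(r - m) div 2. if k \<le> n then
          b ^ n * w ^ (r - m - 2 * n) * binom (real n + real (r - m - 2 * n) + real q - 1) (int (r - m - 2 * n))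
            * (binom (real N + real n - 1) (int n - int k) * F_fun \<alpha> m q k l) else 0)"
      by (intro sum.cong refl) (simp only: fps_mult_left_const_nth coeff sum_distrib_left, intro sum.cong refl, simp)
    also have "\<dots> = (\<Sum>q\<le>m. \<Sum>n\<le>(r - m) div 2. \<Sum>k\<le>m. if k \<le> n then
          b ^ n * w ^ (r - m - 2 * n) * binom (real n + real (r - m - 2 * n) + real q - 1) (int (r - m - 2 * n))
            * (binom (real N + real n - 1) (int n - int k) * F_fun \<alpha> m q k l) else 0)"
      by (intro sum.cong refl sum.swap)
    also have "\<dots> = (\<Sum>q\<le>m. \<Sum>n\<le>(r - m) div 2. \<Psi> n (r - m - 2 * n) q m)"
    proof (intro sum.cong refl)
      fix q n
      have eq: "(\<Sum>k\<le>m. if k \<le> n then f k else 0) = (\<Sum>k=0..min n m. f k)" for f :: "nat \<Rightarrow> real"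
        by (rule sum.mono_neutral_cong_right) auto
      show "(\<Sum>k\<le>m. if k \<le> n then
          b ^ n * w ^ (r - m - 2 * n) * binom (real n + real (r - m - 2 * n) + real q - 1) (int (r - m - 2 * n))
            * (binom (real N + real n - 1) (int n - int k) * F_fun \<alpha> m q k l) else 0)
          = \<Psi> n (r - m - 2 * n) q m"
        unfolding eq \<Psi>_def by (simp only: sum_distrib_left)
    qed
    finally show "(I ^ N * H $ m) $ (r - m) = (\<Sum>q\<le>m. \<Sum>n\<le>(r - m) div 2. \<Psi> n (r - m - 2 * n) q m)" .
  qed
  also have "\<dots> = (\<Sum>(m, q, n)\<in>(SIGMA m:{..r}. {..m} \<times> {..(r - m) div 2}). \<Psi> n (r - m - 2 * n) q m)"
    by (simp add: sum.Sigma sum.cartesian_product)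
  also have "\<dots> = (\<Sum>(n, p, q)\<in>{(n, p, q). 2 * n + p + q \<le> r}. \<Psi> n p q (r - 2 * n - p))"
    by (rule sum.reindex_bij_witness[where j = "\<lambda>(m, q, n). (n, r - m - 2 * n, q)"
          and i = "\<lambda>(n, p, q). (r - 2 * n - p, q, n)"]) auto
  also have "\<dots> = (\<Sum>(n, p, q)\<in>{(n, p, q). 2 * n + p + q \<le> r}.
         1 / \<alpha> ^ n * (1 - 1 / \<alpha>) ^ p * binom (real n + real p + real q - 1) (int p) *
         (\<Sum>k=0..min n (r - 2 * n - p).
            binom (real (sum_list l) + real n - 1) (int n - int k) * F_fun \<alpha> (r - 2 * n - p) q k l))"
    by (simp add: \<Psi>_def b_def w_def N_def power_one_over)
  finally show ?thesis .
qed


section \<open>The coefficients of the expansion in the power sums\<close>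

lemma binom_lower_nat:
  assumes "i \<le> r div 2" "j \<le> r - 2 * i"
  shows "binom (real r + real s - real i - real j - 1) (int r - 2 * int i - int j)
       = real ((r - 2 * i - j + (i + s) - 1) choose (r - 2 * i - j))"
proof -
  define p where "p = r - 2 * i - j"
  have r: "r = p + 2 * i + j" using assms unfolding p_def by simp
  have "real r + real s - real i - real j - 1 = real (i + s) + real p - 1"
    "int r - 2 * int i - int j = int p"
    unfolding r by simp_all
  then show ?thesis
    unfolding p_def[symmetric] by (simp only: binom_shift)
qed

lemma gbinom_Nats:
  assumes "1 \<le> n" "p \<le> n" "1 \<le> k"
  shows "gbinom n p k \<in> \<nat>"
proof -
  have "k dvd n * vec_compositions n p k"
    using assms by (intro dvd_vec_compositions)
  then obtain m where "n * vec_compositions n p k = k * m" ..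
  then have "real n * real (vec_compositions n p k) = real k * real m"
    by (metis of_nat_mult)
  then have "gbinom n p k = real m"
    using assms by (simp add: gbinom_eq field_simps)
  then show ?thesis by simp
qed

lemma Nats_nonneg: "x \<in> \<nat> \<Longrightarrow> 0 \<le> (x :: real)"
  by (auto simp: Nats_def)

lemma Nats_sum: "(\<And>x. x \<in> A \<Longrightarrow> f x \<in> \<nat>) \<Longrightarrow> sum f A \<in> (\<nat> :: real set)"
  by (induction A rule: infinite_finite_induct) (auto intro: Nats_add)

lemma Nats_prod: "(\<And>x. x \<in> A \<Longrightarrow> f x \<in> \<nat>) \<Longrightarrow> prod f A \<in> (\<nat> :: real set)"
  by (induction A rule: infinite_finite_induct) (auto intro: Nats_mult)

lemma gsymb_term_Nats:
  assumes "is_partition \<mu>" "ps \<in> p_decomps \<mu> p" "ks \<in> k_decomps \<mu> k"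
  shows "(\<Prod>i<length \<mu>. gbinom (\<mu> ! i) (ps ! i) (ks ! i)) \<in> \<nat>"
  using assms
  by (intro Nats_prod gbinom_Nats) (auto simp: is_partition_def p_decomps_def k_decomps_def Suc_leI)

lemma gsymb_Nats: "is_partition \<mu> \<Longrightarrow> gsymb \<mu> p k \<in> \<nat>"
  unfolding gsymb_eq by (intro Nats_sum gsymb_term_Nats)

lemma gsymb_eq_0:
  assumes "k < length \<mu>"
  shows "gsymb \<mu> p k = 0"
proof -
  have "length ks \<le> sum_list ks" if "\<forall>x\<in>set ks. 1 \<le> x" for ks :: "nat list"
    using that sum_list_mono[of ks "\<lambda>_. 1" "\<lambda>x. x"] by (simp add: sum_list_triv)
  then have "k_decomps \<mu> k = {}"
    using assms unfolding k_decomps_def by fastforce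
  then show ?thesis by (simp add: gsymb_eq)
qed

text \<open>
  Greedy choice: the first entry takes as much of \<open>k\<close> as its bound and the entries after it allow, the
  latter needing at least 1 each.
\<close>

lemma exists_bounded_k_decomp:
  assumes "\<forall>x\<in>set \<mu>. 1 \<le> x" "length \<mu> \<le> k" "k \<le> sum_list \<mu>"
  shows "\<exists>ks\<in>k_decomps \<mu> k. \<forall>i<length \<mu>. ks ! i \<le> \<mu> ! i"
  using assms
proof (induction \<mu> arbitrary: k)
  case Nil
  then show ?case by (simp add: k_decomps_def)
next
  case (Cons m \<mu>)
  have len: "length \<mu> \<le> sum_list \<mu>"
    using Cons.prems sum_list_mono[of \<mu> "\<lambda>_. 1" "\<lambda>x. x"] by (simp add: sum_list_triv)
  define a where "a = min m (k - length \<mu>)"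
  have "\<exists>ks\<in>k_decomps \<mu> (k - a). \<forall>i<length \<mu>. ks ! i \<le> \<mu> ! i"
    using Cons.prems len by (intro Cons.IH) (auto simp: a_def)
  then obtain ks where ks: "ks \<in> k_decomps \<mu> (k - a)" "\<forall>i<length \<mu>. ks ! i \<le> \<mu> ! i" ..
  have "1 \<le> a" "a \<le> m" "a \<le> k" using Cons.prems by (auto simp: a_def)
  then have "a # ks \<in> k_decomps (m # \<mu>) k" "\<forall>i<length (m # \<mu>). (a # ks) ! i \<le> (m # \<mu>) ! i"
    using ks by (auto simp: k_decomps_def less_Suc_eq_0_disj)
  then show ?case by blast
qed

text \<open>
  Choosing all \<open>p\<^sub>i = 0\<close> turns the one-part symbols into the ordinary binomial coefficients
  \<open>(\<mu>\<^sub>i choose k\<^sub>i)\<close>, which are positive for \<open>k\<^sub>i \<le> \<mu>\<^sub>i\<close>.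
\<close>

lemma gsymb_0_pos:
  assumes "is_partition \<mu>" "length \<mu> \<le> k" "k \<le> sum_list \<mu>"
  shows "0 < gsymb \<mu> 0 k"
proof -
  obtain ks where ks: "ks \<in> k_decomps \<mu> k" "\<forall>i<length \<mu>. ks ! i \<le> \<mu> ! i"
    using exists_bounded_k_decomp[of \<mu> k] assms by (auto simp: is_partition_def Suc_leI)
  let ?t = "\<lambda>ps ks. \<Prod>i<length \<mu>. gbinom (\<mu> ! i) (ps ! i) (ks ! i)"
  define z where "z = replicate (length \<mu>) (0 :: nat)"
  have z: "z \<in> p_decomps \<mu> 0" by (simp add: z_def p_decomps_def sum_list_replicate)
  have nonneg: "0 \<le> ?t ps ks" if "ps \<in> p_decomps \<mu> 0" "ks \<in> k_decomps \<mu> k" for ps ks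
    using that assms by (intro Nats_nonneg gsymb_term_Nats)
  have "0 < ?t z ks"
  proof (rule prod_pos)
    fix i assume i: "i \<in> {..<length \<mu>}"
    then have "1 \<le> ks ! i" "ks ! i \<le> \<mu> ! i"
      using ks by (auto simp: k_decomps_def)
    then show "0 < gbinom (\<mu> ! i) (z ! i) (ks ! i)"
      using i by (simp add: gbinom_eq z_def vec_compositions_def)
  qed
  also have "\<dots> \<le> (\<Sum>ks\<in>k_decomps \<mu> k. ?t z ks)"
    by (rule member_le_sum) (use ks z nonneg in \<open>auto simp: finite_k_decomps\<close>)
  also have "\<dots> \<le> (\<Sum>ps\<in>p_decomps \<mu> 0. \<Sum>ks\<in>k_decomps \<mu> k. ?t ps ks)"
    by (rule member_le_sum) (use z nonneg in \<open>auto simp: finite_p_decomps intro!: sum_nonneg\<close>)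
  finally show ?thesis by (simp add: gsymb_eq)
qed

lemma u_coeff_Nats:
  assumes "i \<le> r div 2" "j \<le> r - 2 * i" "\<rho> \<in> partitions_of j"
  shows "u_coeff \<rho> i j k r \<in> \<nat>"
  unfolding u_coeff_def binom_lower_nat[OF assms(1,2)]
  using assms(3) by (intro Nats_sum Nats_mult gsymb_Nats) (auto simp: partitions_of_def)

text \<open>
  All terms are nonnegative, and they vanish if \<open>\<rho>\<close> has more than \<open>k\<close> parts. Otherwise the term \<open>s = 0\<close>
  decides: its binomial coefficient \<open>(r - i - j - 1 choose r - 2 i - j)\<close> is positive for \<open>i > 0\<close>. If
  \<open>i = 0\<close>, then \<open>k = 0\<close>, so \<open>\<rho>\<close> is empty and \<open>j = 0\<close>, and the only coefficient \<open>(r - 1 choose r)\<close> vanishes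
  unless \<open>r = 0\<close>.
\<close>

lemma u_coeff_pos_iff:
  assumes ij: "i \<le> r div 2" "j \<le> r - 2 * i" and k: "k \<le> min i j" and \<rho>: "\<rho> \<in> partitions_of j"
  shows "0 < u_coeff \<rho> i j k r \<longleftrightarrow> length \<rho> \<le> k \<and> (0 < i + j \<or> r = 0)"
proof -
  have part: "is_partition \<rho>" and sum: "sum_list \<rho> = j"
    using \<rho> by (auto simp: partitions_of_def)
  let ?c = "\<lambda>s. (r - 2 * i - j + (i + s) - 1) choose (r - 2 * i - j)"
  have u: "u_coeff \<rho> i j k r = (\<Sum>s=0..j. gsymb \<rho> s k * real (?c s))"
    unfolding u_coeff_def binom_lower_nat[OF ij] ..
  show ?thesis
  proof (cases "length \<rho> \<le> k \<and> (0 < i + j \<or> r = 0)")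
    case True
    have "0 < ?c 0"
    proof (cases "i = 0")
      case i: True
      then have "j = 0" using True k sum by auto
      then show ?thesis using True i by simp
    next
      case False
      then show ?thesis by (simp add: zero_less_binomial_iff)
    qed
    then have "0 < gsymb \<rho> 0 k * real (?c 0)"
      using True gsymb_0_pos[OF part, of k] k sum by simp
    also have "\<dots> \<le> u_coeff \<rho> i j k r"
      unfolding u using gsymb_Nats[OF part] by (intro member_le_sum) (auto intro: Nats_nonneg)
    finally show ?thesis using True by simp
  next
    case False
    have "gsymb \<rho> s k * real (?c s) = 0" if "s \<le> j" for s
    proof (cases "length \<rho> \<le> k")
      case True
      then have "i = 0" "j = 0" "0 < r" using False by auto
      then show ?thesis using that by (simp add: binomial_eq_0)
    qed (simp add: gsymb_eq_0)
    then have "u_coeff \<rho> i j k r = 0" unfolding u by (intro sum.neutral) auto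
    then show ?thesis using False by simp
  qed
qed

lemma sum_partitions_u_coeff:
  assumes "i \<le> r div 2" "j \<le> r - 2 * i"
  shows "(\<Sum>\<rho>\<in>partitions_of j. u_coeff \<rho> i j k r * (d_part \<alpha> \<rho> l / real (zee \<rho>)))
       = (\<Sum>s=0..j. binom (real i + real (r - 2 * i - j) + real s - 1) (int (r - 2 * i - j)) * F_fun \<alpha> j s k l)"
proof -
  have b: "binom (real r + real s - real i - real j - 1) (int r - 2 * int i - int j)
      = binom (real i + real (r - 2 * i - j) + real s - 1) (int (r - 2 * i - j))" for s
  proof -
    have "real i + real (r - 2 * i - j) + real s - 1 = real (i + s) + real (r - 2 * i - j) - 1"
      by simp
    then show ?thesis by (simp only: binom_lower_nat[OF assms] binom_shift)
  qed
  have "(\<Sum>\<rho>\<in>partitions_of j. u_coeff \<rho> i j k r * (d_part \<alpha> \<rho> l / real (zee \<rho>)))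
      = (\<Sum>\<rho>\<in>partitions_of j. \<Sum>s=0..j. binom (real i + real (r - 2 * i - j) + real s - 1) (int (r - 2 * i - j))
            * (1 / real (zee \<rho>) * gsymb \<rho> s k * d_part \<alpha> \<rho> l))"
    unfolding u_coeff_def b sum_distrib_right by (intro sum.cong refl) simp
  also have "\<dots> = (\<Sum>s=0..j. binom (real i + real (r - 2 * i - j) + real s - 1) (int (r - 2 * i - j)) * F_fun \<alpha> j s k l)"
    by (subst sum.swap) (simp only: F_fun_eq sum_distrib_left)
  finally show ?thesis .
qed

text \<open>
  The expansion in the functions \<open>F\<close>, reordered by \<open>i = n\<close> and \<open>j = r - 2 n - p\<close>.
\<close>

lemma s_sum_eq_u_coeff:
  assumes "0 < \<alpha>" "is_partition l"
  shows "s_sum \<alpha> r l =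
      (\<Sum>i=0..r div 2. \<Sum>j=0..r - 2 * i. \<Sum>k=0..min i j.
         1 / \<alpha> ^ i * (1 - 1 / \<alpha>) ^ (r - 2 * i - j) *
         binom (real (sum_list l) + real i - 1) (int i - int k) *
         (\<Sum>\<rho>\<in>partitions_of j. u_coeff \<rho> i j k r * (d_part \<alpha> \<rho> l / real (zee \<rho>))))"
proof -
  define A where "A i k = binom (real (sum_list l) + real i - 1) (int i - int k)" for i k
  define \<Psi> where "\<Psi> n p q m = 1 / \<alpha> ^ n * (1 - 1 / \<alpha>) ^ p * binom (real n + real p + real q - 1) (int p) *
         (\<Sum>k=0..min n m. A n k * F_fun \<alpha> m q k l)" for n p q m
  have "s_sum \<alpha> r l = (\<Sum>(n, p, q)\<in>{(n, p, q). 2 * n + p + q \<le> r}. \<Psi> n p q (r - 2 * n - p))"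
    unfolding s_sum_eq_F_fun[OF assms] \<Psi>_def A_def ..
  also have "\<dots> = (\<Sum>(i, j, s)\<in>(SIGMA i:{0..r div 2}. SIGMA j:{0..r - 2 * i}. {0..j}). \<Psi> i (r - 2 * i - j) s j)"
    by (rule sum.reindex_bij_witness[where j = "\<lambda>(n, p, q). (n, r - 2 * n - p, q)"
          and i = "\<lambda>(i, j, s). (i, r - 2 * i - j, s)"]) auto
  also have "\<dots> = (\<Sum>i=0..r div 2. \<Sum>j=0..r - 2 * i. \<Sum>s=0..j. \<Psi> i (r - 2 * i - j) s j)"
    by (simp add: sum.Sigma)
  also have "\<dots> = (\<Sum>i=0..r div 2. \<Sum>j=0..r - 2 * i. \<Sum>k=0..min i j.
         1 / \<alpha> ^ i * (1 - 1 / \<alpha>) ^ (r - 2 * i - j) * A i k *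
         (\<Sum>\<rho>\<in>partitions_of j. u_coeff \<rho> i j k r * (d_part \<alpha> \<rho> l / real (zee \<rho>))))"
  proof (rule sum.cong[OF refl], rule sum.cong[OF refl])
    fix i j assume "i \<in> {0..r div 2}" "j \<in> {0..r - 2 * i}"
    then have ij: "i \<le> r div 2" "j \<le> r - 2 * i" by auto
    show "(\<Sum>s=0..j. \<Psi> i (r - 2 * i - j) s j) = (\<Sum>k=0..min i j.
         1 / \<alpha> ^ i * (1 - 1 / \<alpha>) ^ (r - 2 * i - j) * A i k *
         (\<Sum>\<rho>\<in>partitions_of j. u_coeff \<rho> i j k r * (d_part \<alpha> \<rho> l / real (zee \<rho>))))"
      unfolding sum_partitions_u_coeff[OF ij] \<Psi>_def sum_distrib_left
      by (subst sum.swap) (intro sum.cong refl, simp only: mult_ac)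
  qed
  finally show ?thesis unfolding A_def .
qed

theorem theorem8p1:
  fixes \<alpha> :: real and l :: "nat list" and r :: nat
  assumes "0 < \<alpha>" and "is_partition l"
  shows "s_sum \<alpha> r l =
      (\<Sum>i=0..r div 2. \<Sum>j=0..r - 2 * i. \<Sum>k=0..min i j.
         1 / \<alpha> ^ i * (1 - 1 / \<alpha>) ^ (r - 2 * i - j) *
         binom (real (sum_list l) + real i - 1) (int i - int k) *
         (\<Sum>\<rho>\<in>partitions_of j. u_coeff \<rho> i j k r * (d_part \<alpha> \<rho> l / real (zee \<rho>))))
    \<and> (\<forall>i j k \<rho>. i \<le> r div 2 \<longrightarrow> j \<le> r - 2 * i \<longrightarrow> k \<le> min i j \<longrightarrow> \<rho> \<in> partitions_of j \<longrightarrow>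
         u_coeff \<rho> i j k r \<in> \<nat> \<and>
         (0 < u_coeff \<rho> i j k r \<longleftrightarrow> length \<rho> \<le> k \<and> (0 < i + j \<or> r = 0)))
    \<and> s_sum \<alpha> r l =
      (\<Sum>(n, p, q)\<in>{(n, p, q). 2 * n + p + q \<le> r}.
         1 / \<alpha> ^ n * (1 - 1 / \<alpha>) ^ p *
         binom (real n + real p + real q - 1) (int p) *
         (\<Sum>k=0..min n (r - 2 * n - p).
            binom (real (sum_list l) + real n - 1) (int n - int k) *
            F_fun \<alpha> (r - 2 * n - p) q k l))"
proof (intro conjI allI impI)
  show "u_coeff \<rho> i j k r \<in> \<nat>"
    if "i \<le> r div 2" "j \<le> r - 2 * i" "k \<le> min i j" "\<rho> \<in> partitions_of j" for i j k \<rho>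
    using that by (intro u_coeff_Nats)
  show "0 < u_coeff \<rho> i j k r \<longleftrightarrow> length \<rho> \<le> k \<and> (0 < i + j \<or> r = 0)"
    if "i \<le> r div 2" "j \<le> r - 2 * i" "k \<le> min i j" "\<rho> \<in> partitions_of j" for i j k \<rho>
    using that by (intro u_coeff_pos_iff)
qed (rule s_sum_eq_u_coeff[OF assms], rule s_sum_eq_F_fun[OF assms])

end
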